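(* Let $\mathcal F$ be a saturated fusion system on a finite $2$-group $S$, and suppose that $P\leq S$ is fully $\mathcal F$-automized. Then the homomorphism $\mathrm{tr}^{\mathcal F}_P:(B(P)^\times)^{\mathrm{Out}_S(P)}\to(B(P)^\times)^{\mathrm{Out}_{\mathcal F}(P)}$ is split surjective, and $$(B(P)^\times)^{\mathrm{Out}_S(P)}=\mathrm{Ker}(\mathrm{tr}^{\mathcal F}_P)\times(B(P)^\times)^{\mathrm{Out}_{\mathcal F}(P)}$$ (internal direct product).
   Context: Burnside rings: for a finite group $G$, $B(G)$ is the Grothendieck ring of finite left $G$-sets, with addition $[X]+[Y]=[X\sqcup Y]$ and multiplication $[X][Y]=[X\times Y]$. For $H\leq G$, the map $[X]\mapsto|X^H|$ extends to a ring morphism $B(G)\to\mathbb Z$, written $a\mapsto|a^H|$; the map $a\mapsto(|a^H|)_{H\leq G}$ is injective, so $B(G)^\times$ is a finite elementary abelian $2$-group. Fusion systems: a fusion system $\mathcal F$ on a finite $p$-group $S$ is a category whose objects are the subgroups of $S$ and whose morphisms are injective group homomorphisms, such that for $P,Q\leq S$ one has $\mathrm{Hom}_S(P,Q)\subseteq\mathrm{Hom}_{\mathcal F}(P,Q)$ (where $\mathrm{Hom}_S(P,Q)$ is the set of homomorphisms given by conjugation by an element of $S$), and every $\varphi\in\mathrm{Hom}_{\mathcal F}(P,Q)$ is the composition of an isomorphism in $\mathcal F$ and an inclusion of subgroups. Subgroups $P,Q$ are $\mathcal F$-conjugate if they are isomorphic in $\mathcal F$. $\mathrm{Aut}_{\mathcal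 F}(P)=\mathrm{Hom}_{\mathcal F}(P,P)$, $\mathrm{Aut}_S(P)=\mathrm{Hom}_S(P,P)$, $\mathrm{Out}_{\mathcal F}(P)=\mathrm{Aut}_{\mathcal F}(P)/\mathrm{Inn}(P)$, $\mathrm{Out}_S(P)=\mathrm{Aut}_S(P)/\mathrm{Inn}(P)$. $P$ is fully $\mathcal F$-automized if $\mathrm{Aut}_S(P)\in\mathrm{Syl}_p(\mathrm{Aut}_{\mathcal F}(P))$, and receptive if every isomorphism $\varphi:Q\to P$ in $\mathcal F$ extends to a morphism in $\mathcal F$ defined on $N_\varphi=\{g\in N_S(Q):\varphi c_g\varphi^{-1}\in\mathrm{Aut}_S(P)\}$, where $c_g$ is conjugation by $g$. $\mathcal F$ is saturated if every subgroup of $S$ is $\mathcal F$-conjugate to one that is fully $\mathcal F$-automized and receptive. Outer action: $\mathrm{Aut}(P)$ acts on $B(P)$ by ring automorphisms, where $\alpha\cdot[X]$ is the class of the $P$-set $X$ with action transported along $\alpha$ (i.e. $g$ acts as $\alpha^{-1}(g)$); equivalently $|(\alpha\cdot b)^Q|=|b^{\alpha^{-1}(Q)}|$ for $Q\leq P$. $\mathrm{Inn}(P)$ acts trivially, so $\mathrm{Out}(P)$ acts on $B(P)$ and on $B(P)^\times$; for $\Gamma\leq\mathrm{Out}(P)$, $(B(P)^\times)^\Gamma$ denotes the $\Gamma$-fixed points. Trace map: for $P\leq S$, $\mathrm{tr}^{\mathcal F}_P:(B(P)^\times)^{\mathrm{Out}_S(P)}\to(B(P)^\times)^{\mathrm{Out}_{\mathcal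 F}(P)}$ is the group homomorphism $b\mapsto\prod_{\alpha}(\alpha\cdot b)$, where $\alpha$ runs over any set of representatives of the left cosets $\mathrm{Out}_{\mathcal F}(P)/\mathrm{Out}_S(P)$. *)

theory Defs
  imports
    "HOL-Algebra.Group_Action"
    "HOL-Algebra.Left_Coset"
    "HOL-Algebra.Elementary_Groups"
    "HOL-Algebra.FiniteProduct"
    "HOL-Algebra.Ring"
    "HOL-Computational_Algebra.Primes"
begin

section \<open>Finite G-sets\<close>

type_synonym ('g, 'x) gset = "'x set \<times> ('g \<Rightarrow> 'x \<Rightarrow> 'x)"

definition finite_gsets :: "('g, 'm) monoid_scheme \<Rightarrow> ('g, 'x) gset set" where
  "finite_gsets G = {(E, \<phi>). finite E \<and> group_action G E \<phi>}"

definition gset_iso :: "('g, 'm) monoid_scheme \<Rightarrow> ('g, 'x) gset \<Rightarrow> ('g, 'y) gset \<Rightarrow> bool" where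
  "gset_iso G X Y \<longleftrightarrow>
     (\<exists>f. bij_betw f (fst X) (fst Y) \<and>
          (\<forall>g\<in>carrier G. \<forall>x\<in>fst X. f (snd X g x) = snd Y g (f x)))"

definition gset_sum :: "('g, 'x) gset \<Rightarrow> ('g, 'y) gset \<Rightarrow> ('g, 'x + 'y) gset" where
  "gset_sum X Y =
     (fst X <+> fst Y, \<lambda>g. restrict (map_sum (snd X g) (snd Y g)) (fst X <+> fst Y))"

definition gset_prod :: "('g, 'x) gset \<Rightarrow> ('g, 'y) gset \<Rightarrow> ('g, 'x \<times> 'y) gset" where
  "gset_prod X Y =
     (fst X \<times> fst Y, \<lambda>g. restrict (map_prod (snd X g) (snd Y g)) (fst X \<times> fst Y))"

text \<open>Every finite G-set has an isomorphic copy whose points are natural numbers, so isomorphism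
  classes of finite G-sets are represented inside the type of G-sets on naturals, whatever
  the type of the points of the given G-set.\<close>

type_synonym 'g gset_class = "('g, nat) gset set"

definition gset_class :: "('g, 'm) monoid_scheme \<Rightarrow> ('g, 'x) gset \<Rightarrow> 'g gset_class" where
  "gset_class G X = {Y \<in> finite_gsets G. gset_iso G X Y}"

definition burnside_semiring :: "('g, 'm) monoid_scheme \<Rightarrow> 'g gset_class ring" where
  "burnside_semiring G =
     \<lparr>carrier = gset_class G ` (finite_gsets G :: ('g, nat) gset set),
      monoid.mult = (\<lambda>a b. \<Union>X\<in>a. \<Union>Y\<in>b. gset_class G (gset_prod X Y)),
      one = gset_class G ({()}, \<lambda>g. \<lambda>x\<in>{()}. x),
      zero = gset_class G ({} :: nat set, \<lambda>g. \<lambda>x\<in>{}. x),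
      add = (\<lambda>a b. \<Union>X\<in>a. \<Union>Y\<in>b. gset_class G (gset_sum X Y))\<rparr>"


section \<open>Grothendieck ring of a commutative semiring\<close>

text \<open>The pair (x, y) stands for the formal difference x - y.\<close>

definition grothendieck_rel :: "('a, 'm) ring_scheme \<Rightarrow> (('a \<times> 'a) \<times> ('a \<times> 'a)) set" where
  "grothendieck_rel M =
     {((x, y), (x', y')). x \<in> carrier M \<and> y \<in> carrier M \<and> x' \<in> carrier M \<and> y' \<in> carrier M \<and>
        (\<exists>z\<in>carrier M. x \<oplus>\<^bsub>M\<^esub> y' \<oplus>\<^bsub>M\<^esub> z = x' \<oplus>\<^bsub>M\<^esub> y \<oplus>\<^bsub>M\<^esub> z)}"

definition grothendieck :: "('a, 'm) ring_scheme \<Rightarrow> ('a \<times> 'a) set ring" where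
  "grothendieck M =
     \<lparr>carrier = (carrier M \<times> carrier M) // grothendieck_rel M,
      monoid.mult = (\<lambda>a b. \<Union>(x, y)\<in>a. \<Union>(x', y')\<in>b. grothendieck_rel M ``
        {(x \<otimes>\<^bsub>M\<^esub> x' \<oplus>\<^bsub>M\<^esub> y \<otimes>\<^bsub>M\<^esub> y', x \<otimes>\<^bsub>M\<^esub> y' \<oplus>\<^bsub>M\<^esub> y \<otimes>\<^bsub>M\<^esub> x')}),
      one = grothendieck_rel M `` {(\<one>\<^bsub>M\<^esub>, \<zero>\<^bsub>M\<^esub>)},
      zero = grothendieck_rel M `` {(\<zero>\<^bsub>M\<^esub>, \<zero>\<^bsub>M\<^esub>)},
      add = (\<lambda>a b. \<Union>(x, y)\<in>a. \<Union>(x', y')\<in>b. grothendieck_rel M ``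
        {(x \<oplus>\<^bsub>M\<^esub> x', y \<oplus>\<^bsub>M\<^esub> y')})\<rparr>"

definition grothendieck_map ::
    "('b, 'm) ring_scheme \<Rightarrow> ('a \<Rightarrow> 'b) \<Rightarrow> ('a \<times> 'a) set \<Rightarrow> ('b \<times> 'b) set" where
  "grothendieck_map M h a = (\<Union>(x, y)\<in>a. grothendieck_rel M `` {(h x, h y)})"


section \<open>The Burnside ring and the action of automorphisms\<close>

type_synonym 'g burnside = "('g gset_class \<times> 'g gset_class) set"

definition burnside_ring :: "('g, 'm) monoid_scheme \<Rightarrow> 'g burnside ring" where
  "burnside_ring G = grothendieck (burnside_semiring G)"

definition gset_twist ::
    "('g, 'm) monoid_scheme \<Rightarrow> ('g \<Rightarrow> 'g) \<Rightarrow> ('g, 'x) gset \<Rightarrow> ('g, 'x) gset" where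
  "gset_twist G \<alpha> X = (fst X, \<lambda>g. snd X (inv_into (carrier G) \<alpha> g))"

definition aut_act ::
    "('g, 'm) monoid_scheme \<Rightarrow> ('g \<Rightarrow> 'g) \<Rightarrow> 'g burnside \<Rightarrow> 'g burnside" where
  "aut_act G \<alpha> =
     grothendieck_map (burnside_semiring G) (\<lambda>c. \<Union>X\<in>c. gset_class G (gset_twist G \<alpha> X))"

text \<open>An element of Out(G) is a coset of Inn(G). Inner automorphisms act trivially on the
  Burnside ring, so the choice of the representative is irrelevant.\<close>

definition out_act ::
    "('g, 'm) monoid_scheme \<Rightarrow> ('g \<Rightarrow> 'g) set \<Rightarrow> 'g burnside \<Rightarrow> 'g burnside" where
  "out_act G \<omega> = aut_act G (SOME \<alpha>. \<alpha> \<in> \<omega>)"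

definition fixed_units ::
    "('g, 'm) monoid_scheme \<Rightarrow> ('g \<Rightarrow> 'g) set set \<Rightarrow> 'g burnside monoid" where
  "fixed_units G \<Gamma> = (units_of (burnside_ring G))
     \<lparr>carrier := {u \<in> Units (burnside_ring G). \<forall>\<omega>\<in>\<Gamma>. out_act G \<omega> u = u}\<rparr>"


section \<open>Fusion systems\<close>

text \<open>A fusion system is represented by its morphism sets: \<open>F P Q\<close> is the set of morphisms from
  \<open>P\<close> to \<open>Q\<close>, as extensional functions on \<open>P\<close>; it is only meaningful for subgroups \<open>P\<close>, \<open>Q\<close>.\<close>

type_synonym 'a homsets = "'a set \<Rightarrow> 'a set \<Rightarrow> ('a \<Rightarrow> 'a) set"

definition conj_homs :: "('a, 'm) monoid_scheme \<Rightarrow> 'a homsets" where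
  "conj_homs S P Q =
     {\<lambda>x\<in>P. g \<otimes>\<^bsub>S\<^esub> x \<otimes>\<^bsub>S\<^esub> inv\<^bsub>S\<^esub> g | g.
        g \<in> carrier S \<and> (\<forall>x\<in>P. g \<otimes>\<^bsub>S\<^esub> x \<otimes>\<^bsub>S\<^esub> inv\<^bsub>S\<^esub> g \<in> Q)}"

definition fusion_isos :: "'a homsets \<Rightarrow> 'a homsets" where
  "fusion_isos F P Q =
     {\<phi> \<in> F P Q. \<exists>\<psi>\<in>F Q P. compose P \<psi> \<phi> = (\<lambda>x\<in>P. x) \<and> compose Q \<phi> \<psi> = (\<lambda>x\<in>Q. x)}"

locale fusion_system = group S for p :: nat and S (structure) and F :: "'a homsets" +
  assumes prime_p: "prime p"
    and order_S: "\<exists>n. order S = p ^ n"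
    and hom_mono: "\<lbrakk>subgroup P S; subgroup Q S\<rbrakk> \<Longrightarrow>
      F P Q \<subseteq> mon (S\<lparr>carrier := P\<rparr>) (S\<lparr>carrier := Q\<rparr>) \<inter> extensional P"
    and comp_closed: "\<lbrakk>subgroup P S; subgroup Q S; subgroup R S; \<phi> \<in> F P Q; \<psi> \<in> F Q R\<rbrakk> \<Longrightarrow>
      compose P \<psi> \<phi> \<in> F P R"
    and conj_homs_subset: "\<lbrakk>subgroup P S; subgroup Q S\<rbrakk> \<Longrightarrow> conj_homs S P Q \<subseteq> F P Q"
    and iso_incl_factorization: "\<lbrakk>subgroup P S; subgroup Q S; \<phi> \<in> F P Q\<rbrakk> \<Longrightarrow>
      \<exists>R. subgroup R S \<and> R \<subseteq> Q \<and> (\<exists>\<psi>\<in>fusion_isos F P R. \<phi> = compose P (\<lambda>x\<in>R. x) \<psi>)"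

definition aut_group :: "('a, 'm) monoid_scheme \<Rightarrow> 'a homsets \<Rightarrow> 'a set \<Rightarrow> ('a \<Rightarrow> 'a) monoid" where
  "aut_group S F P = (AutoGroup (S\<lparr>carrier := P\<rparr>))\<lparr>carrier := F P P\<rparr>"

definition inn :: "('a, 'm) monoid_scheme \<Rightarrow> 'a set \<Rightarrow> ('a \<Rightarrow> 'a) set" where
  "inn S P = conj_homs (S\<lparr>carrier := P\<rparr>) P P"

text \<open>Taking \<open>F = conj_homs S\<close> in \<open>aut_group\<close> and \<open>out_group\<close> gives the groups
  Aut_S(P) and Out_S(P).\<close>

definition out_group ::
    "('a, 'm) monoid_scheme \<Rightarrow> 'a homsets \<Rightarrow> 'a set \<Rightarrow> ('a \<Rightarrow> 'a) set monoid" where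
  "out_group S F P = aut_group S F P Mod inn S P"

definition sylow_subgroup :: "nat \<Rightarrow> 'a set \<Rightarrow> ('a, 'm) monoid_scheme \<Rightarrow> bool" where
  "sylow_subgroup p H G \<longleftrightarrow> subgroup H G \<and> card H = p ^ multiplicity p (order G)"

definition fully_automized ::
    "nat \<Rightarrow> ('a, 'm) monoid_scheme \<Rightarrow> 'a homsets \<Rightarrow> 'a set \<Rightarrow> bool" where
  "fully_automized p S F P \<longleftrightarrow> sylow_subgroup p (conj_homs S P P) (aut_group S F P)"

text \<open>The group N_phi for an isomorphism phi from \<open>Q\<close> to \<open>P\<close>.\<close>

definition extension_domain ::
    "('a, 'm) monoid_scheme \<Rightarrow> 'a set \<Rightarrow> 'a set \<Rightarrow> ('a \<Rightarrow> 'a) \<Rightarrow> 'a set" where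
  "extension_domain S Q P \<phi> =
     {g \<in> normalizer S Q.
        (\<lambda>x\<in>P. \<phi> (g \<otimes>\<^bsub>S\<^esub> inv_into Q \<phi> x \<otimes>\<^bsub>S\<^esub> inv\<^bsub>S\<^esub> g)) \<in> conj_homs S P P}"

definition receptive :: "('a, 'm) monoid_scheme \<Rightarrow> 'a homsets \<Rightarrow> 'a set \<Rightarrow> bool" where
  "receptive S F P \<longleftrightarrow>
     (\<forall>Q \<phi>. subgroup Q S \<and> \<phi> \<in> fusion_isos F Q P \<longrightarrow>
        (\<exists>\<psi>\<in>F (extension_domain S Q P \<phi>) (carrier S). \<forall>x\<in>Q. \<psi> x = \<phi> x))"

locale saturated_fusion_system = fusion_system +
  assumes saturated: "subgroup P S \<Longrightarrow>
    \<exists>Q. subgroup Q S \<and> fusion_isos F P Q \<noteq> {} \<and> fully_automized p S F Q \<and> receptive S F Q"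


section \<open>Trace map, split surjections and internal direct products\<close>

definition left_transversal :: "('a, 'm) monoid_scheme \<Rightarrow> 'a set \<Rightarrow> 'a set \<Rightarrow> bool" where
  "left_transversal G H T \<longleftrightarrow>
     T \<subseteq> carrier G \<and> (\<forall>C \<in> lcosets\<^bsub>G\<^esub> H. \<exists>!t. t \<in> T \<and> t \<in> C)"

definition trace_map ::
    "('g, 'm) monoid_scheme \<Rightarrow> ('g \<Rightarrow> 'g) set set \<Rightarrow> 'g burnside \<Rightarrow> 'g burnside" where
  "trace_map G T b = (\<Otimes>\<^bsub>units_of (burnside_ring G)\<^esub>\<omega>\<in>T. out_act G \<omega> b)"

definition split_surjective ::
    "('a, 'm) monoid_scheme \<Rightarrow> ('b, 'n) monoid_scheme \<Rightarrow> ('a \<Rightarrow> 'b) \<Rightarrow> bool" where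
  "split_surjective G H h \<longleftrightarrow>
     h \<in> epi G H \<and> (\<exists>s\<in>hom H G. \<forall>y\<in>carrier H. h (s y) = y)"

definition internal_direct_product :: "('a, 'm) monoid_scheme \<Rightarrow> 'a set \<Rightarrow> 'a set \<Rightarrow> bool" where
  "internal_direct_product G A B \<longleftrightarrow>
     A \<lhd> G \<and> B \<lhd> G \<and> A \<inter> B = {\<one>\<^bsub>G\<^esub>} \<and> A <#>\<^bsub>G\<^esub> B = carrier G"

end

theory Submission
  imports Defs
begin

text \<open>A finite G-set is determined up to isomorphism by its marks, the numbers of fixed points of the
  subgroups H of G. Hence the Burnside ring embeds into a product of copies of the integers, and
  each of its units has order at most 2. The group \<open>Out\<^sub>F(P)\<close> acts on the units through the marks,
  and \<open>Out\<^sub>S(P)\<close> has odd index in it because \<open>Aut\<^sub>S(P)\<close> is a Sylow 2-subgroup of \<open>Aut\<^sub>F(P)\<close>. On a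
  unit \<open>b\<close> fixed by \<open>Out\<^sub>F(P)\<close> the trace is therefore an odd power of \<open>b\<close>, that is, \<open>b\<close> itself: the
  inclusion of the fixed points splits the trace.\<close>

section \<open>Marks of finite G-sets\<close>

text \<open>The obstacle is the encoding: an element of the Burnside ring is a class of pairs of
  isomorphism classes, and every operation on such elements is a union over representatives.
  Independence of representatives, the ring laws and the properties of the action would each call
  for their own isomorphisms of G-sets. The injectivity of the marks is therefore proved once. After
  that each identity is checked one subgroup at a time: sums and products become integer arithmetic,
  and an automorphism only changes the subgroup at which a mark is taken. The trace itself is then a
  matter of abstract group theory, in which G-sets no longer occur.\<close>

definition mark :: "'g set \<Rightarrow> ('g, 'x) gset \<Rightarrow> nat" where
  "mark H X = card {x \<in> fst X. \<forall>h\<in>H. snd X h x = x}"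

text \<open>In \<open>group_action\<close> every \<open>\<phi> g\<close> is extensional on the set
  acted on, a property that invariant subsets generally do not inherit. This variant passes with the
  same \<open>\<phi>\<close> to an orbit and to its complement.\<close>

definition acts_on :: "('g, 'm) monoid_scheme \<Rightarrow> ('g \<Rightarrow> 'x \<Rightarrow> 'x) \<Rightarrow> 'x set \<Rightarrow> bool" where
  "acts_on G \<phi> E \<longleftrightarrow>
     (\<forall>g\<in>carrier G. \<forall>x\<in>E. \<phi> g x \<in> E) \<and> (\<forall>x\<in>E. \<phi> \<one>\<^bsub>G\<^esub> x = x) \<and>
     (\<forall>g\<in>carrier G. \<forall>h\<in>carrier G. \<forall>x\<in>E. \<phi> (g \<otimes>\<^bsub>G\<^esub> h) x = \<phi> g (\<phi> h x))"

lemma (in group) acts_onD: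
  assumes "acts_on G \<phi> E"
  shows "\<lbrakk>g \<in> carrier G; x \<in> E\<rbrakk> \<Longrightarrow> \<phi> g x \<in> E"
    and "x \<in> E \<Longrightarrow> \<phi> \<one> x = x"
    and "\<lbrakk>g \<in> carrier G; h \<in> carrier G; x \<in> E\<rbrakk> \<Longrightarrow> \<phi> (g \<otimes> h) x = \<phi> g (\<phi> h x)"
    and "\<lbrakk>g \<in> carrier G; x \<in> E\<rbrakk> \<Longrightarrow> \<phi> (inv g) (\<phi> g x) = x"
    and "\<lbrakk>g \<in> carrier G; x \<in> E\<rbrakk> \<Longrightarrow> \<phi> g (\<phi> (inv g) x) = x"
proof -
  show 1: "\<lbrakk>g \<in> carrier G; x \<in> E\<rbrakk> \<Longrightarrow> \<phi> g x \<in> E" for g x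
    using assms by (simp add: acts_on_def)
  show 2: "x \<in> E \<Longrightarrow> \<phi> \<one> x = x" for x
    using assms by (simp add: acts_on_def)
  show 3: "\<lbrakk>g \<in> carrier G; h \<in> carrier G; x \<in> E\<rbrakk> \<Longrightarrow> \<phi> (g \<otimes> h) x = \<phi> g (\<phi> h x)" for g h x
    using assms by (simp add: acts_on_def)
  show "\<lbrakk>g \<in> carrier G; x \<in> E\<rbrakk> \<Longrightarrow> \<phi> (inv g) (\<phi> g x) = x"
    using 2 3[of "inv g" g x] by simp
  show "\<lbrakk>g \<in> carrier G; x \<in> E\<rbrakk> \<Longrightarrow> \<phi> g (\<phi> (inv g) x) = x"
    using 2 3[of g "inv g" x] by simp
qed

lemma (in group) group_action_iff_acts_on:
  "group_action G E \<phi> \<longleftrightarrow> acts_on G \<phi> E \<and> (\<forall>g\<in>carrier G. \<phi> g \<in> extensional E)"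
proof
  assume "group_action G E \<phi>"
  then interpret group_action G E \<phi> .
  have "\<phi> \<one> x = x" if "x \<in> E" for x
    using that unfolding id_eq_one[symmetric] by simp
  then show "acts_on G \<phi> E \<and> (\<forall>g\<in>carrier G. \<phi> g \<in> extensional E)"
    using element_image composition_rule Bij_imp_extensional[OF bij_prop0]
    unfolding acts_on_def by blast
next
  assume *: "acts_on G \<phi> E \<and> (\<forall>g\<in>carrier G. \<phi> g \<in> extensional E)"
  note D = acts_onD[OF conjunct1[OF *]]
  have Bij: "\<phi> g \<in> Bij E" if "g \<in> carrier G" for g
  proof -
    have "bij_betw (\<phi> g) E E"
      by (rule bij_betwI[where g = "\<phi> (inv g)"]) (use D that in auto)
    with * that show ?thesis by (simp add: Bij_def)
  qed
  show "group_action G E \<phi>"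
  proof (intro group_action.intro group_hom.intro group_hom_axioms.intro homI)
    fix g h assume gh: "g \<in> carrier G" "h \<in> carrier G"
    have "\<phi> (g \<otimes> h) = compose E (\<phi> g) (\<phi> h)"
      using gh * D by (intro extensionalityI[of _ E]) (auto simp: compose_def)
    then show "\<phi> (g \<otimes> h) = \<phi> g \<otimes>\<^bsub>BijGroup E\<^esub> \<phi> h"
      using Bij gh by (simp add: BijGroup_def)
  next
    show "\<phi> g \<in> carrier (BijGroup E)" if "g \<in> carrier G" for g
      using Bij that by (simp add: BijGroup_def)
  qed (simp_all add: group_axioms group_BijGroup)
qed

lemma (in group) acts_on_cong:
  assumes "\<And>g x. \<lbrakk>g \<in> carrier G; x \<in> E\<rbrakk> \<Longrightarrow> \<phi> g x = \<psi> g x" and "acts_on G \<psi> E"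
  shows "acts_on G \<phi> E"
  using assms by (auto simp: acts_on_def)

lemma (in group) finite_gsets_restrictI:
  assumes "finite E" "acts_on G \<phi> E"
  shows "(E, \<lambda>g. restrict (\<phi> g) E) \<in> finite_gsets G"
  unfolding finite_gsets_def
  using assms by (auto simp: group_action_iff_acts_on intro: acts_on_cong)

lemma (in group) finite_gsetsD:
  assumes "X \<in> finite_gsets G"
  shows "finite (fst X)" "acts_on G (snd X) (fst X)"
    "g \<in> carrier G \<Longrightarrow> snd X g \<in> extensional (fst X)"
  using assms by (auto simp: finite_gsets_def group_action_iff_acts_on)

text \<open>An equivariant injection reflects fixed points as well as preserving them:
  \<open>f (h x) = f x\<close> forces \<open>h x = x\<close>.\<close>

lemma (in group) mark_eq_if_gset_iso:
  assumes iso: "gset_iso G X Y" and X: "acts_on G (snd X) (fst X)" and H: "H \<subseteq> carrier G"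
  shows "mark H X = mark H Y"
proof -
  obtain f where f: "bij_betw f (fst X) (fst Y)"
    and eq: "\<And>g x. \<lbrakk>g \<in> carrier G; x \<in> fst X\<rbrakk> \<Longrightarrow> f (snd X g x) = snd Y g (f x)"
    using iso by (auto simp: gset_iso_def)
  have "snd Y h (f x) = f x \<longleftrightarrow> snd X h x = x" if "h \<in> H" "x \<in> fst X" for h x
    using eq[of h x] that H acts_onD(1)[OF X, of h x] bij_betw_imp_inj_on[OF f]
    by (metis inj_onD subsetD)
  then have "f ` {x \<in> fst X. \<forall>h\<in>H. snd X h x = x} = {y \<in> fst Y. \<forall>h\<in>H. snd Y h y = y}"
    unfolding bij_betw_imp_surj_on[OF f, symmetric] by auto
  moreover have "inj_on f {x \<in> fst X. \<forall>h\<in>H. snd X h x = x}"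
    using bij_betw_imp_inj_on[OF f] by (rule inj_on_subset) auto
  ultimately show ?thesis
    unfolding mark_def using card_image by fastforce
qed

lemma gset_iso_Un:
  assumes "gset_iso G (A, \<phi>) (B, \<psi>)" "gset_iso G (A', \<phi>) (B', \<psi>)"
    and disj: "A \<inter> A' = {}" "B \<inter> B' = {}"
    and inv: "\<And>g x. \<lbrakk>g \<in> carrier G; x \<in> A\<rbrakk> \<Longrightarrow> \<phi> g x \<in> A"
      "\<And>g x. \<lbrakk>g \<in> carrier G; x \<in> A'\<rbrakk> \<Longrightarrow> \<phi> g x \<in> A'"
  shows "gset_iso G (A \<union> A', \<phi>) (B \<union> B', \<psi>)"
proof -
  obtain f where f: "bij_betw f A B"
    "\<And>g x. \<lbrakk>g \<in> carrier G; x \<in> A\<rbrakk> \<Longrightarrow> f (\<phi> g x) = \<psi> g (f x)"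
    using assms(1) by (auto simp: gset_iso_def)
  obtain f' where f': "bij_betw f' A' B'"
    "\<And>g x. \<lbrakk>g \<in> carrier G; x \<in> A'\<rbrakk> \<Longrightarrow> f' (\<phi> g x) = \<psi> g (f' x)"
    using assms(2) by (auto simp: gset_iso_def)
  have "bij_betw (\<lambda>x. if x \<in> A then f x else f' x) (A \<union> A') (B \<union> B')"
    using f f' disj by (intro bij_betw_disjoint_Un) auto
  \<comment> \<open>The point stays in \<open>A'\<close>, so the case distinction evaluates it by
    \<open>f'\<close> again.\<close>
  moreover have "\<phi> g x \<notin> A" if "g \<in> carrier G" "x \<in> A'" for g x
    using inv(2)[OF that] disj by auto
  ultimately show ?thesis
    unfolding gset_iso_def using f f' inv disj
    by (intro exI[of _ "\<lambda>x. if x \<in> A then f x else f' x"]) auto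
qed

lemma mark_Un:
  assumes "finite A" "finite B" "A \<inter> B = {}"
  shows "mark H (A \<union> B, \<phi>) = mark H (A, \<phi>) + mark H (B, \<phi>)"
proof -
  have "{x \<in> A \<union> B. \<forall>h\<in>H. \<phi> h x = x} = {x \<in> A. \<forall>h\<in>H. \<phi> h x = x} \<union> {x \<in> B. \<forall>h\<in>H. \<phi> h x = x}"
    by auto
  then show ?thesis
    unfolding mark_def using assms by (simp, subst card_Un_disjoint) auto
qed

section \<open>Orbits and stabilizers\<close>

lemma (in group) stabilizer_subgroup_acts_on:
  assumes "acts_on G \<phi> E" "x \<in> E"
  shows "subgroup (stabilizer G \<phi> x) G"
proof (rule subgroupI)
  note D = acts_onD[OF assms(1)]
  show "stabilizer G \<phi> x \<noteq> {}"
    using D(2) assms(2) by (auto simp: stabilizer_def)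
  show "inv g \<in> stabilizer G \<phi> x" if "g \<in> stabilizer G \<phi> x" for g
    using D(4)[of g x] that assms(2) by (auto simp: stabilizer_def)
qed (use acts_onD(3)[OF assms(1)] assms(2) in \<open>auto simp: stabilizer_def\<close>)

lemma (in group) acts_on_orbit:
  assumes "acts_on G \<phi> E" "x \<in> E"
  shows "orbit G \<phi> x \<subseteq> E" "acts_on G \<phi> (orbit G \<phi> x)" "acts_on G \<phi> (E - orbit G \<phi> x)"
proof -
  note D = acts_onD[OF assms(1)]
  show O: "orbit G \<phi> x \<subseteq> E"
    using D assms(2) by (auto simp: orbit_def)
  have inv: "\<phi> g y \<in> orbit G \<phi> x" if g: "g \<in> carrier G" and "y \<in> orbit G \<phi> x" for g y
  proof -
    obtain h where h: "h \<in> carrier G" "y = \<phi> h x"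
      using \<open>y \<in> orbit G \<phi> x\<close> by (auto simp: orbit_def)
    then have "\<phi> g y = \<phi> (g \<otimes> h) x"
      using D(3) g assms(2) by simp
    then show ?thesis
      using g h by (auto simp: orbit_def)
  qed
  then show "acts_on G \<phi> (orbit G \<phi> x)"
    using assms(1) O unfolding acts_on_def by blast
  have "y \<in> orbit G \<phi> x" if "g \<in> carrier G" "y \<in> E" "\<phi> g y \<in> orbit G \<phi> x" for g y
    using inv[of "inv g" "\<phi> g y"] D(4) that by simp
  then show "acts_on G \<phi> (E - orbit G \<phi> x)"
    using assms(1) unfolding acts_on_def by blast
qed

text \<open>Whether two group elements agree at \<open>x\<close> depends only on the stabilizer.
  This allows orbits in different sets to be compared without passing through coset spaces.\<close>

lemma (in group) acts_on_eq_iff: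
  assumes act: "acts_on G \<phi> E" and x: "x \<in> E" and g: "g \<in> carrier G" and h: "h \<in> carrier G"
  shows "\<phi> g x = \<phi> h x \<longleftrightarrow> inv h \<otimes> g \<in> stabilizer G \<phi> x"
proof -
  note D = acts_onD[OF act]
  have "\<phi> (inv h \<otimes> g) x = \<phi> (inv h) (\<phi> g x)"
    using D(3) x g h by simp
  moreover have "\<phi> (inv h) (\<phi> g x) = x \<longleftrightarrow> \<phi> g x = \<phi> h x"
    using D(1)[OF g x] D(4)[OF h x] D(5)[OF h] by metis
  ultimately show ?thesis
    using g h by (simp add: stabilizer_def)
qed

text \<open>The map from \<open>g x\<close> to \<open>g y\<close> is well defined and injective,
  since both coincidences are governed by the same stabilizer.\<close>

lemma (in group) gset_iso_orbits:
  assumes "acts_on G \<phi> A" "acts_on G \<psi> B" and x: "x \<in> A" and y: "y \<in> B"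
    and stab: "stabilizer G \<phi> x = stabilizer G \<psi> y"
  shows "gset_iso G (orbit G \<phi> x, \<phi>) (orbit G \<psi> y, \<psi>)"
proof -
  note D = acts_onD[OF assms(1)] and D' = acts_onD[OF assms(2)]
  have iff: "\<phi> g x = \<phi> h x \<longleftrightarrow> \<psi> g y = \<psi> h y" if "g \<in> carrier G" "h \<in> carrier G" for g h
    using acts_on_eq_iff[OF assms(1) x that] acts_on_eq_iff[OF assms(2) y that] stab by simp
  \<comment> \<open>\<open>SOME\<close> picks any \<open>g\<close> that moves \<open>x\<close> to
    \<open>z\<close>; by \<open>iff\<close> the choice does not affect the image of
    \<open>y\<close>.\<close>
  define f where "f z = \<psi> (SOME g. g \<in> carrier G \<and> \<phi> g x = z) y" for z
  have f: "f (\<phi> g x) = \<psi> g y" if "g \<in> carrier G" for g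
  proof -
    have "(SOME h. h \<in> carrier G \<and> \<phi> h x = \<phi> g x) \<in> carrier G \<and>
        \<phi> (SOME h. h \<in> carrier G \<and> \<phi> h x = \<phi> g x) x = \<phi> g x"
      by (rule someI[of _ g]) (use that in auto)
    then show ?thesis
      using iff that unfolding f_def by blast
  qed
  have "bij_betw f (orbit G \<phi> x) (orbit G \<psi> y)"
  proof -
    have "orbit G \<phi> x = (\<lambda>g. \<phi> g x) ` carrier G" "orbit G \<psi> y = (\<lambda>g. \<psi> g y) ` carrier G"
      by (auto simp: orbit_def)
    then show ?thesis
      unfolding bij_betw_def inj_on_def by (simp add: image_image f iff)
  qed
  moreover have "f (\<phi> g z) = \<psi> g (f z)" if g: "g \<in> carrier G" and z: "z \<in> orbit G \<phi> x" for g z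
  proof -
    obtain h where h: "h \<in> carrier G" "z = \<phi> h x"
      using z by (auto simp: orbit_def)
    then have "\<phi> g z = \<phi> (g \<otimes> h) x" "\<psi> g (\<psi> h y) = \<psi> (g \<otimes> h) y"
      using D(3) D'(3) g x y by auto
    then show ?thesis
      using f h g by simp
  qed
  ultimately show ?thesis
    by (auto simp: gset_iso_def)
qed

lemma mark_nonzero_iff:
  assumes "finite A"
  shows "mark H (A, \<phi>) \<noteq> 0 \<longleftrightarrow> (\<exists>x\<in>A. \<forall>h\<in>H. \<phi> h x = x)"
  using assms by (auto simp: mark_def)

text \<open>A subgroup that is maximal among those with a nonzero mark is the stabilizer of each of its
  fixed points. So both G-sets contain an orbit of the same type, which can be split off.\<close>

theorem (in group) gset_iso_if_mark_eq:
  assumes fin: "finite (carrier G)"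
    and "finite A" "finite B" "acts_on G \<phi> A" "acts_on G \<psi> B"
    and "\<And>H. subgroup H G \<Longrightarrow> mark H (A, \<phi>) = mark H (B, \<psi>)"
  shows "gset_iso G (A, \<phi>) (B, \<psi>)"
  using assms(2-)
proof (induction A arbitrary: B rule: finite_psubset_induct)
  case (psubset A)
  note marks = psubset.prems(4)
  \<comment> \<open>The trivial subgroup fixes every point, so equal marks include equal
    cardinalities. This settles the empty case and makes \<open>\<H>\<close> nonempty in the
    other.\<close>
  have one: "mark {\<one>} (A, \<phi>) = card A" "mark {\<one>} (B, \<psi>) = card B"
    using acts_onD(2)[OF psubset.prems(2)] acts_onD(2)[OF psubset.prems(3)]
    unfolding mark_def by (auto intro!: arg_cong[where f = card])
  have cards: "card A = card B"
    using marks[OF triv_subgroup] one by simp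
  show ?case
  proof (cases "A = {}")
    case True
    then have "B = {}"
      using cards \<open>finite B\<close> by simp
    with True show ?thesis
      by (simp add: gset_iso_def bij_betw_def)
  next
    case False
    define \<H> where "\<H> = {H. subgroup H G \<and> mark H (A, \<phi>) \<noteq> 0}"
    have "\<H> \<subseteq> Pow (carrier G)"
      using subgroup.subset unfolding \<H>_def by blast
    then have "finite \<H>"
      using fin by (meson finite_Pow_iff finite_subset)
    moreover have "\<H> \<noteq> {}"
      using triv_subgroup one False \<open>finite A\<close> unfolding \<H>_def by auto
    ultimately obtain H where H: "H \<in> \<H>" and max: "\<And>K. \<lbrakk>K \<in> \<H>; H \<subseteq> K\<rbrakk> \<Longrightarrow> H = K"
      using finite_has_maximal[of \<H>] by blast
    have HG: "H \<subseteq> carrier G"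
      using H subgroup.subset unfolding \<H>_def by blast
    have "mark H (A, \<phi>) \<noteq> 0" "mark H (B, \<psi>) \<noteq> 0"
      using H marks unfolding \<H>_def by auto
    then obtain x y where x: "x \<in> A" "\<And>h. h \<in> H \<Longrightarrow> \<phi> h x = x"
      and y: "y \<in> B" "\<And>h. h \<in> H \<Longrightarrow> \<psi> h y = y"
      unfolding mark_nonzero_iff[OF \<open>finite A\<close>] mark_nonzero_iff[OF \<open>finite B\<close>] by blast
    have "stabilizer G \<phi> x \<in> \<H>"
      using x mark_nonzero_iff[OF \<open>finite A\<close>] stabilizer_subgroup_acts_on[OF psubset.prems(2) x(1)]
      unfolding \<H>_def by (auto simp: stabilizer_def)
    moreover have "H \<subseteq> stabilizer G \<phi> x"
      using x HG by (auto simp: stabilizer_def)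
    ultimately have Hx: "H = stabilizer G \<phi> x"
      by (rule max)
    \<comment> \<open>The family \<open>\<H>\<close> is defined by the marks of \<open>A\<close>; as
      the marks agree, maximality applies to stabilizers of points of \<open>B\<close> too.\<close>
    have "stabilizer G \<psi> y \<in> \<H>"
      using y mark_nonzero_iff[OF \<open>finite B\<close>] stabilizer_subgroup_acts_on[OF psubset.prems(3) y(1)]
      unfolding \<H>_def by (auto simp: stabilizer_def marks)
    moreover have "H \<subseteq> stabilizer G \<psi> y"
      using y HG by (auto simp: stabilizer_def)
    ultimately have Hy: "H = stabilizer G \<psi> y"
      by (rule max)
    let ?O = "orbit G \<phi> x" and ?O' = "orbit G \<psi> y"
    note O = acts_on_orbit[OF psubset.prems(2) x(1)]
    note O' = acts_on_orbit[OF psubset.prems(3) y(1)]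
    have iso: "gset_iso G (?O, \<phi>) (?O', \<psi>)"
      using psubset.prems(2,3) x(1) y(1) Hx[symmetric, unfolded Hy] by (rule gset_iso_orbits)
    have A: "A = ?O \<union> (A - ?O)" and B: "B = ?O' \<union> (B - ?O')"
      using O(1) O'(1) by blast+
    have "gset_iso G (A - ?O, \<phi>) (B - ?O', \<psi>)"
    proof (rule psubset.IH)
      have "x \<in> ?O"
        using acts_onD(2)[OF psubset.prems(2) x(1)] unfolding orbit_def by force
      then show "A - ?O \<subset> A"
        using x by blast
      fix K assume K: "subgroup K G"
      \<comment> \<open>Marks are additive over the splitting and isomorphic orbits contribute
        equally, so the complements have equal marks by cancellation.\<close>
      have "mark K (A, \<phi>) = mark K (?O, \<phi>) + mark K (A - ?O, \<phi>)"
        by (subst A, rule mark_Un) (use \<open>finite A\<close> O(1) finite_subset in auto)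
      moreover have "mark K (B, \<psi>) = mark K (?O', \<psi>) + mark K (B - ?O', \<psi>)"
        by (subst B, rule mark_Un) (use \<open>finite B\<close> O'(1) finite_subset in auto)
      moreover have "mark K (?O, \<phi>) = mark K (?O', \<psi>)"
        by (rule mark_eq_if_gset_iso[OF iso]) (use O(2) subgroup.subset[OF K] in simp_all)
      ultimately show "mark K (A - ?O, \<phi>) = mark K (B - ?O', \<psi>)"
        using marks[OF K] by simp
    qed (use \<open>finite B\<close> O(3) O'(3) in simp_all)
    with iso have "gset_iso G (?O \<union> (A - ?O), \<phi>) (?O' \<union> (B - ?O'), \<psi>)"
      by (rule gset_iso_Un) (use acts_onD(1)[OF O(2)] acts_onD(1)[OF O(3)] in blast)+
    then show ?thesis
      unfolding A[symmetric] B[symmetric] .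
  qed
qed

lemma mark_gset_sum:
  assumes "finite (fst X)" "finite (fst Y)"
  shows "mark H (gset_sum X Y) = mark H X + mark H Y"
proof -
  have "{z \<in> fst (gset_sum X Y). \<forall>h\<in>H. snd (gset_sum X Y) h z = z} =
      {x \<in> fst X. \<forall>h\<in>H. snd X h x = x} <+> {y \<in> fst Y. \<forall>h\<in>H. snd Y h y = y}"
    by (auto simp: gset_sum_def)
  then show ?thesis
    unfolding mark_def using assms by (simp add: card_Plus)
qed

lemma mark_gset_prod:
  "mark H (gset_prod X Y) = mark H X * mark H Y"
proof -
  have "{z \<in> fst (gset_prod X Y). \<forall>h\<in>H. snd (gset_prod X Y) h z = z} =
      {x \<in> fst X. \<forall>h\<in>H. snd X h x = x} \<times> {y \<in> fst Y. \<forall>h\<in>H. snd Y h y = y}"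
    by (auto simp: gset_prod_def)
  then show ?thesis
    unfolding mark_def by (simp add: card_cartesian_product)
qed

section \<open>Isomorphism classes of finite G-sets\<close>

locale finite_group = group G for G :: "('g, 'm) monoid_scheme" (structure) +
  assumes finite_carrier: "finite (carrier G)"
begin

lemma gset_sum_closed:
  assumes "X \<in> finite_gsets G" "Y \<in> finite_gsets G"
  shows "gset_sum X Y \<in> finite_gsets G"
  unfolding gset_sum_def
  by (rule finite_gsets_restrictI)
    (use acts_onD[OF finite_gsetsD(2)[OF assms(1)]] acts_onD[OF finite_gsetsD(2)[OF assms(2)]]
       finite_gsetsD(1)[OF assms(1)] finite_gsetsD(1)[OF assms(2)] in \<open>auto simp: acts_on_def\<close>)

lemma gset_prod_closed:
  assumes "X \<in> finite_gsets G" "Y \<in> finite_gsets G"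
  shows "gset_prod X Y \<in> finite_gsets G"
  unfolding gset_prod_def
  by (rule finite_gsets_restrictI)
    (use acts_onD[OF finite_gsetsD(2)[OF assms(1)]] acts_onD[OF finite_gsetsD(2)[OF assms(2)]]
       finite_gsetsD(1)[OF assms(1)] finite_gsetsD(1)[OF assms(2)] in \<open>auto simp: acts_on_def\<close>)

text \<open>From here on every isomorphism claim is a comparison of numbers, also between G-sets
  whose points have different types.\<close>

lemma gset_iso_iff_mark_eq:
  assumes "X \<in> finite_gsets G" "Y \<in> finite_gsets G"
  shows "gset_iso G X Y \<longleftrightarrow> (\<forall>H. subgroup H G \<longrightarrow> mark H Y = mark H X)"
  using gset_iso_if_mark_eq[OF finite_carrier, of "fst X" "fst Y" "snd X" "snd Y"]
    mark_eq_if_gset_iso[of X Y] finite_gsetsD[OF assms(1)] finite_gsetsD[OF assms(2)]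
  by (auto dest: subgroup.subset simp: eq_commute)

lemma gset_class_eq:
  assumes "X \<in> finite_gsets G"
  shows "gset_class G X = {Y \<in> finite_gsets G. \<forall>H. subgroup H G \<longrightarrow> mark H Y = mark H X}"
  unfolding gset_class_def by (simp add: gset_iso_iff_mark_eq[OF assms] cong: conj_cong)

text \<open>The action is transported along an injection into the naturals. Over an empty class the
  unions that define the operations would collapse.\<close>

lemma gset_class_nonempty:
  fixes X :: "('g, 'x) gset"
  assumes X: "X \<in> finite_gsets G"
  obtains Y where "Y \<in> gset_class G X"
proof -
  note D = acts_onD[OF finite_gsetsD(2)[OF X]]
  obtain f :: "'x \<Rightarrow> nat" where f: "inj_on f (fst X)"
    using finite_imp_inj_to_nat_seg[OF finite_gsetsD(1)[OF X]] by blast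
  define \<psi> where "\<psi> g y = f (snd X g (inv_into (fst X) f y))" for g y
  have \<psi>: "\<psi> g (f x) = f (snd X g x)" if "x \<in> fst X" for g x
    using f that by (simp add: \<psi>_def)
  define Y where "Y = (f ` fst X, \<lambda>g. restrict (\<psi> g) (f ` fst X))"
  have "acts_on G \<psi> (f ` fst X)"
    using D \<psi> by (simp add: acts_on_def)
  then have "Y \<in> finite_gsets G"
    unfolding Y_def using finite_gsetsD(1)[OF X] by (intro finite_gsets_restrictI) auto
  moreover have "gset_iso G X Y"
    unfolding gset_iso_def Y_def
    by (rule exI[of _ f]) (use D \<psi> f in \<open>auto simp: bij_betw_def\<close>)
  ultimately show thesis
    using that by (auto simp: gset_class_def)
qed

definition class_mark :: "'g set \<Rightarrow> 'g gset_class \<Rightarrow> nat" where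
  "class_mark H c = mark H (SOME X. X \<in> c)"

lemma class_mark_gset_class:
  assumes "X \<in> finite_gsets G" "subgroup H G"
  shows "class_mark H (gset_class G X) = mark H X"
proof -
  have "(SOME Y. Y \<in> gset_class G X) \<in> gset_class G X"
    using gset_class_nonempty[OF assms(1)] by (metis someI)
  then show ?thesis
    using gset_class_eq[OF assms(1)] assms(2) by (simp add: class_mark_def)
qed

text \<open>The points of \<open>X\<close> may have any type, so \<open>X\<close> need not be a
  member of its own class; its marks are recovered from the class through
  \<open>class_mark\<close>.\<close>

lemma gset_class_eq_iff:
  assumes "X \<in> finite_gsets G" "Y \<in> finite_gsets G"
  shows "gset_class G X = gset_class G Y \<longleftrightarrow> (\<forall>H. subgroup H G \<longrightarrow> mark H X = mark H Y)"
proof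
  assume "gset_class G X = gset_class G Y"
  then show "\<forall>H. subgroup H G \<longrightarrow> mark H X = mark H Y"
    using class_mark_gset_class[OF assms(1)] class_mark_gset_class[OF assms(2)] by simp
qed (simp add: gset_class_eq assms)

lemma carrier_burnside_semiring:
  "carrier (burnside_semiring G) = gset_class G ` (finite_gsets G :: ('g, nat) gset set)"
  by (simp add: burnside_semiring_def)

lemma gset_class_closed:
  assumes X: "X \<in> finite_gsets G"
  shows "gset_class G X \<in> carrier (burnside_semiring G)"
proof -
  obtain Y where "Y \<in> gset_class G X"
    by (rule gset_class_nonempty[OF X])
  then have "Y \<in> finite_gsets G" "\<forall>H. subgroup H G \<longrightarrow> mark H Y = mark H X"
    using gset_class_eq[OF X] by auto
  then have "Y \<in> finite_gsets G" "gset_class G X = gset_class G Y"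
    using gset_class_eq_iff[OF X, of Y] by simp_all
  then show ?thesis
    by (simp add: carrier_burnside_semiring)
qed

text \<open>Serves to evaluate operations given as unions over representatives: there is at least
  one representative, and all of them contribute the same set.\<close>

lemma UN_gset_class:
  assumes X: "X \<in> finite_gsets G"
    and F: "\<And>Y. Y \<in> finite_gsets G \<Longrightarrow> \<forall>H. subgroup H G \<longrightarrow> mark H Y = mark H X \<Longrightarrow> F Y = C"
  shows "(\<Union>Y\<in>gset_class G X. F Y) = C"
proof -
  obtain Y where "Y \<in> gset_class G X"
    by (rule gset_class_nonempty[OF X])
  then show ?thesis
    using F gset_class_eq[OF X] by (intro UN_constant_eq) auto
qed

lemma add_gset_class:
  assumes "X \<in> finite_gsets G" "Y \<in> finite_gsets G"
  shows "gset_class G X \<oplus>\<^bsub>burnside_semiring G\<^esub> gset_class G Y = gset_class G (gset_sum X Y)"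
proof -
  have "gset_class G (gset_sum X' Y') = gset_class G (gset_sum X Y)"
    if "X' \<in> finite_gsets G" "\<forall>H. subgroup H G \<longrightarrow> mark H X' = mark H X"
      "Y' \<in> finite_gsets G" "\<forall>H. subgroup H G \<longrightarrow> mark H Y' = mark H Y"
    for X' Y' :: "('g, nat) gset"
    using that assms by (subst gset_class_eq_iff) (auto simp: gset_sum_closed mark_gset_sum finite_gsetsD)
  then show ?thesis
    by (simp add: burnside_semiring_def) (intro UN_gset_class assms)
qed

lemma mult_gset_class:
  assumes "X \<in> finite_gsets G" "Y \<in> finite_gsets G"
  shows "gset_class G X \<otimes>\<^bsub>burnside_semiring G\<^esub> gset_class G Y = gset_class G (gset_prod X Y)"
proof -
  have "gset_class G (gset_prod X' Y') = gset_class G (gset_prod X Y)"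
    if "X' \<in> finite_gsets G" "\<forall>H. subgroup H G \<longrightarrow> mark H X' = mark H X"
      "Y' \<in> finite_gsets G" "\<forall>H. subgroup H G \<longrightarrow> mark H Y' = mark H Y"
    for X' Y' :: "('g, nat) gset"
    using that assms by (subst gset_class_eq_iff) (auto simp: gset_prod_closed mark_gset_prod)
  then show ?thesis
    by (simp add: burnside_semiring_def) (intro UN_gset_class assms)
qed

lemma trivial_gset_closed: "finite E \<Longrightarrow> (E, \<lambda>g. \<lambda>x\<in>E. x) \<in> finite_gsets G"
  using finite_gsets_restrictI[of E "\<lambda>g x. x"] by (simp add: acts_on_def)

lemma mark_trivial_gset: "mark H (E, \<lambda>g. \<lambda>x\<in>E. x) = card E"
  by (simp add: mark_def cong: conj_cong)

end

section \<open>Grothendieck rings of semirings with marks\<close>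

text \<open>The marks embed \<open>M\<close> in a product of copies of the natural numbers, so the
  semiring laws and additive cancellation are inherited from there through
  \<open>marks_inject\<close>.\<close>

locale semiring_with_marks =
  fixes M :: "('b, 'n) ring_scheme" (structure) and I :: "'i set" and m :: "'i \<Rightarrow> 'b \<Rightarrow> nat"
  assumes closed: "\<zero> \<in> carrier M" "\<one> \<in> carrier M"
      "\<lbrakk>x \<in> carrier M; y \<in> carrier M\<rbrakk> \<Longrightarrow> x \<oplus> y \<in> carrier M"
      "\<lbrakk>x \<in> carrier M; y \<in> carrier M\<rbrakk> \<Longrightarrow> x \<otimes> y \<in> carrier M"
    and marks: "i \<in> I \<Longrightarrow> m i \<zero> = 0" "i \<in> I \<Longrightarrow> m i \<one> = 1"
      "\<lbrakk>i \<in> I; x \<in> carrier M; y \<in> carrier M\<rbrakk> \<Longrightarrow> m i (x \<oplus> y) = m i x + m i y"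
      "\<lbrakk>i \<in> I; x \<in> carrier M; y \<in> carrier M\<rbrakk> \<Longrightarrow> m i (x \<otimes> y) = m i x * m i y"
    and marks_inject:
      "\<lbrakk>x \<in> carrier M; y \<in> carrier M; \<And>i. i \<in> I \<Longrightarrow> m i x = m i y\<rbrakk> \<Longrightarrow> x = y"
begin

abbreviation diff :: "'b \<Rightarrow> 'b \<Rightarrow> ('b \<times> 'b) set" where
  "diff x y \<equiv> grothendieck_rel M `` {(x, y)}"

abbreviation R :: "('b \<times> 'b) set ring" where
  "R \<equiv> grothendieck M"

text \<open>The auxiliary summand \<open>z\<close> cancels in the natural numbers, mark by mark,
  which leaves a comparison of integer differences.\<close>

lemma grothendieck_rel_iff:
  "((x, y), (x', y')) \<in> grothendieck_rel M \<longleftrightarrow>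
     x \<in> carrier M \<and> y \<in> carrier M \<and> x' \<in> carrier M \<and> y' \<in> carrier M \<and>
     (\<forall>i\<in>I. int (m i x) - int (m i y) = int (m i x') - int (m i y'))"
    (is "?L \<longleftrightarrow> ?x \<and> ?y \<and> ?x' \<and> ?y' \<and> ?R")
proof
  assume L: ?L
  then obtain z where C: ?x ?y ?x' ?y' and z: "z \<in> carrier M" "x \<oplus> y' \<oplus> z = x' \<oplus> y \<oplus> z"
    by (auto simp: grothendieck_rel_def)
  have ?R
  proof
    fix i assume "i \<in> I"
    have "m i (x \<oplus> y' \<oplus> z) = m i (x' \<oplus> y \<oplus> z)"
      by (rule arg_cong[OF z(2)])
    then have "m i x + m i y' + m i z = m i x' + m i y + m i z"
      using C z(1) \<open>i \<in> I\<close> by (simp add: marks closed)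
    then show "int (m i x) - int (m i y) = int (m i x') - int (m i y')"
      by linarith
  qed
  with C show "?x \<and> ?y \<and> ?x' \<and> ?y' \<and> ?R"
    by blast
next
  assume CR: "?x \<and> ?y \<and> ?x' \<and> ?y' \<and> ?R"
  \<comment> \<open>Equal marks give equality without any auxiliary summand, so zero serves as the
    witness \<open>z\<close>.\<close>
  have "x \<oplus> y' \<oplus> \<zero> = x' \<oplus> y \<oplus> \<zero>"
  proof (rule marks_inject)
    fix i assume "i \<in> I"
    then show "m i (x \<oplus> y' \<oplus> \<zero>) = m i (x' \<oplus> y \<oplus> \<zero>)"
      using CR by (simp add: marks closed) (smt (verit) of_nat_add of_nat_eq_iff)
  qed (use CR closed in auto)
  then show ?L
    using CR closed by (auto simp: grothendieck_rel_def)
qed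

lemma equiv_grothendieck_rel: "equiv (carrier M \<times> carrier M) (grothendieck_rel M)"
  by (intro equivI refl_onI symI transI) (auto simp: grothendieck_rel_iff)

lemma grothendieck_cases:
  assumes "a \<in> carrier R"
  obtains x y where "x \<in> carrier M" "y \<in> carrier M" "a = diff x y"
  using assms by (auto simp: grothendieck_def quotient_def)

lemma diff_closed: "\<lbrakk>x \<in> carrier M; y \<in> carrier M\<rbrakk> \<Longrightarrow> diff x y \<in> carrier R"
  by (auto simp: grothendieck_def quotient_def)

lemma diff_eqI:
  assumes "x \<in> carrier M" "y \<in> carrier M" "x' \<in> carrier M" "y' \<in> carrier M"
    and "\<And>i. i \<in> I \<Longrightarrow> int (m i x) - int (m i y) = int (m i x') - int (m i y')"
  shows "diff x y = diff x' y'"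
  using assms by (intro equiv_class_eq[OF equiv_grothendieck_rel]) (simp add: grothendieck_rel_iff)

text \<open>For the Burnside semiring this is the integer \<open>|a^H|\<close>, extended from G-sets
  to formal differences; \<open>SOME\<close> picks one of the pairs in the class.\<close>

definition grothendieck_mark :: "'i \<Rightarrow> ('b \<times> 'b) set \<Rightarrow> int" where
  "grothendieck_mark i a = (case SOME z. z \<in> a of (x, y) \<Rightarrow> int (m i x) - int (m i y))"

lemma grothendieck_mark_diff:
  assumes "x \<in> carrier M" "y \<in> carrier M" "i \<in> I"
  shows "grothendieck_mark i (diff x y) = int (m i x) - int (m i y)"
proof -
  have "(SOME z. z \<in> diff x y) \<in> diff x y"
    by (rule someI[of _ "(x, y)"]) (use assms in \<open>simp add: grothendieck_rel_iff\<close>)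
  then show ?thesis
    using assms(3) by (auto simp: grothendieck_mark_def grothendieck_rel_iff split: prod.split)
qed

lemma grothendieck_mark_inject:
  assumes "a \<in> carrier R" "b \<in> carrier R"
    and "\<And>i. i \<in> I \<Longrightarrow> grothendieck_mark i a = grothendieck_mark i b"
  shows "a = b"
proof -
  obtain x y where x: "x \<in> carrier M" "y \<in> carrier M" "a = diff x y"
    using grothendieck_cases[OF assms(1)] .
  obtain x' y' where x': "x' \<in> carrier M" "y' \<in> carrier M" "b = diff x' y'"
    using grothendieck_cases[OF assms(2)] .
  show ?thesis
    unfolding x x' by (rule diff_eqI) (use assms(3) x x' grothendieck_mark_diff in auto)
qed

lemma UN_diff:
  assumes "x \<in> carrier M" "y \<in> carrier M"
    and "\<And>x' y'. \<lbrakk>x' \<in> carrier M; y' \<in> carrier M;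
      \<And>i. i \<in> I \<Longrightarrow> int (m i x) - int (m i y) = int (m i x') - int (m i y')\<rbrakk> \<Longrightarrow> f x' y' = C"
  shows "(\<Union>(x', y')\<in>diff x y. f x' y') = C"
  by (rule UN_constant_eq[of "(x, y)"]) (use assms in \<open>auto simp: grothendieck_rel_iff\<close>)

lemma mult_diff:
  assumes "x \<in> carrier M" "y \<in> carrier M" "x' \<in> carrier M" "y' \<in> carrier M"
  shows "diff x y \<otimes>\<^bsub>R\<^esub> diff x' y' = diff (x \<otimes> x' \<oplus> y \<otimes> y') (x \<otimes> y' \<oplus> y \<otimes> x')"
proof -
  have *: "diff (u \<otimes> u' \<oplus> v \<otimes> v') (u \<otimes> v' \<oplus> v \<otimes> u') =
      diff (x \<otimes> x' \<oplus> y \<otimes> y') (x \<otimes> y' \<oplus> y \<otimes> x')"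
    if "u \<in> carrier M" "v \<in> carrier M" "u' \<in> carrier M" "v' \<in> carrier M"
      and u: "\<And>i. i \<in> I \<Longrightarrow> int (m i x) - int (m i y) = int (m i u) - int (m i v)"
      and u': "\<And>i. i \<in> I \<Longrightarrow> int (m i x') - int (m i y') = int (m i u') - int (m i v')"
    for u v u' v'
  proof (rule diff_eqI)
    fix i assume i: "i \<in> I"
    show "int (m i (u \<otimes> u' \<oplus> v \<otimes> v')) - int (m i (u \<otimes> v' \<oplus> v \<otimes> u')) =
        int (m i (x \<otimes> x' \<oplus> y \<otimes> y')) - int (m i (x \<otimes> y' \<oplus> y \<otimes> x'))"
      \<comment> \<open>Each side expands to a product of two differences of marks; multiplying the
        equations \<open>u\<close> and \<open>u'\<close> identifies them.\<close>
      using that assms i arg_cong2[OF u[OF i] u'[OF i], of "(*)"]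
      by (simp add: marks closed algebra_simps)
  qed (use that assms closed in auto)
  then show ?thesis
    by (simp add: grothendieck_def) (intro UN_diff assms, rule *)
qed

lemma mult_grothendieck:
  assumes "a \<in> carrier R" "b \<in> carrier R"
  shows "a \<otimes>\<^bsub>R\<^esub> b \<in> carrier R"
    and "i \<in> I \<Longrightarrow> grothendieck_mark i (a \<otimes>\<^bsub>R\<^esub> b) = grothendieck_mark i a * grothendieck_mark i b"
proof -
  obtain x y where x: "x \<in> carrier M" "y \<in> carrier M" "a = diff x y"
    using grothendieck_cases[OF assms(1)] .
  obtain x' y' where x': "x' \<in> carrier M" "y' \<in> carrier M" "b = diff x' y'"
    using grothendieck_cases[OF assms(2)] .
  show "a \<otimes>\<^bsub>R\<^esub> b \<in> carrier R"
    unfolding x x' by (simp add: mult_diff x x' closed diff_closed)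
  show "i \<in> I \<Longrightarrow> grothendieck_mark i (a \<otimes>\<^bsub>R\<^esub> b) = grothendieck_mark i a * grothendieck_mark i b"
    unfolding x x' by (simp add: mult_diff x x' closed grothendieck_mark_diff marks algebra_simps)
qed

lemma one_grothendieck:
  "\<one>\<^bsub>R\<^esub> \<in> carrier R" "i \<in> I \<Longrightarrow> grothendieck_mark i \<one>\<^bsub>R\<^esub> = 1"
proof -
  have "\<one>\<^bsub>R\<^esub> = diff \<one> \<zero>"
    by (simp add: grothendieck_def)
  then show "\<one>\<^bsub>R\<^esub> \<in> carrier R" "i \<in> I \<Longrightarrow> grothendieck_mark i \<one>\<^bsub>R\<^esub> = 1"
    by (simp_all add: diff_closed closed grothendieck_mark_diff marks)
qed

text \<open>Each law holds in the integers at every mark and is pulled back by injectivity.\<close>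

lemma comm_monoid_grothendieck: "comm_monoid R"
proof (rule comm_monoidI)
  fix a b c assume "a \<in> carrier R" "b \<in> carrier R" "c \<in> carrier R"
  then show "a \<otimes>\<^bsub>R\<^esub> b \<otimes>\<^bsub>R\<^esub> c = a \<otimes>\<^bsub>R\<^esub> (b \<otimes>\<^bsub>R\<^esub> c)"
    by (intro grothendieck_mark_inject) (simp_all add: mult_grothendieck)
next
  fix a b assume "a \<in> carrier R" "b \<in> carrier R"
  then show "a \<otimes>\<^bsub>R\<^esub> b = b \<otimes>\<^bsub>R\<^esub> a"
    by (intro grothendieck_mark_inject) (simp_all add: mult_grothendieck)
next
  fix a assume "a \<in> carrier R"
  then show "\<one>\<^bsub>R\<^esub> \<otimes>\<^bsub>R\<^esub> a = a"
    by (intro grothendieck_mark_inject) (simp_all add: mult_grothendieck one_grothendieck)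
qed (auto intro: mult_grothendieck one_grothendieck)

text \<open>Each mark of a unit is an invertible integer, hence 1 or -1.\<close>

lemma Units_grothendieck_square:
  assumes "u \<in> Units R"
  shows "u \<otimes>\<^bsub>R\<^esub> u = \<one>\<^bsub>R\<^esub>"
proof -
  obtain v where u: "u \<in> carrier R" and v: "v \<in> carrier R" "u \<otimes>\<^bsub>R\<^esub> v = \<one>\<^bsub>R\<^esub>"
    using assms by (auto simp: Units_def)
  have "grothendieck_mark i u * grothendieck_mark i u = 1" if "i \<in> I" for i
  proof -
    have "grothendieck_mark i u * grothendieck_mark i v = 1"
      using mult_grothendieck(2)[OF u v(1) that] one_grothendieck(2)[OF that] v(2) by simp
    then show ?thesis
      by (auto simp: zmult_eq_1_iff)
  qed
  then show ?thesis
    using u by (intro grothendieck_mark_inject) (simp_all add: mult_grothendieck one_grothendieck)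
qed

text \<open>The function \<open>k\<close> records where a mark of the image is to be read in the
  argument. For the twist by \<alpha> it sends a subgroup to its preimage under \<alpha>.\<close>

lemma grothendieck_map:
  assumes h: "\<And>x. x \<in> carrier M \<Longrightarrow> h x \<in> carrier M"
    and k: "\<And>i. i \<in> I \<Longrightarrow> k i \<in> I" "\<And>i x. \<lbrakk>i \<in> I; x \<in> carrier M\<rbrakk> \<Longrightarrow> m i (h x) = m (k i) x"
    and a: "a \<in> carrier R"
  shows "grothendieck_map M h a \<in> carrier R"
    and "i \<in> I \<Longrightarrow> grothendieck_mark i (grothendieck_map M h a) = grothendieck_mark (k i) a"
proof -
  obtain x y where x: "x \<in> carrier M" "y \<in> carrier M" "a = diff x y"
    using grothendieck_cases[OF a] .
  have eq: "grothendieck_map M h a = diff (h x) (h y)"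
    unfolding grothendieck_map_def x
    by (intro UN_diff x diff_eqI h) (auto simp: k x)
  show "grothendieck_map M h a \<in> carrier R"
    using eq by (simp add: diff_closed h x)
  show "i \<in> I \<Longrightarrow> grothendieck_mark i (grothendieck_map M h a) = grothendieck_mark (k i) a"
    unfolding eq by (simp add: grothendieck_mark_diff h k x)
qed

end

text \<open>The substantial condition is \<open>marks_inject\<close>, which rests on
  \<open>gset_iso_if_mark_eq\<close>; the others are closure properties and counts of fixed
  points.\<close>

sublocale finite_group \<subseteq> burnside:
  semiring_with_marks "burnside_semiring G" "{H. subgroup H G}" class_mark
proof
  let ?M = "burnside_semiring G"
  have zero: "\<zero>\<^bsub>?M\<^esub> = gset_class G ({} :: nat set, \<lambda>g. \<lambda>x\<in>{}. x)"
    and one: "\<one>\<^bsub>?M\<^esub> = gset_class G ({()}, \<lambda>g. \<lambda>x\<in>{()}. x)"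
    by (simp_all add: burnside_semiring_def)
  show "\<zero>\<^bsub>?M\<^esub> \<in> carrier ?M" "\<one>\<^bsub>?M\<^esub> \<in> carrier ?M"
    unfolding zero one by (simp_all only: gset_class_closed trivial_gset_closed finite.intros)
  show "class_mark H \<zero>\<^bsub>?M\<^esub> = 0" "class_mark H \<one>\<^bsub>?M\<^esub> = 1" if "H \<in> {H. subgroup H G}" for H
    using that class_mark_gset_class[OF trivial_gset_closed[of "{} :: nat set"], of H]
      class_mark_gset_class[OF trivial_gset_closed[of "{()}"], of H]
      mark_trivial_gset[of H "{} :: nat set"] mark_trivial_gset[of H "{()}"]
    unfolding zero one by simp_all
  fix x y assume xy: "x \<in> carrier ?M" "y \<in> carrier ?M"
  then obtain X Y :: "('g, nat) gset" where X: "X \<in> finite_gsets G" "x = gset_class G X"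
    and Y: "Y \<in> finite_gsets G" "y = gset_class G Y"
    by (auto simp: carrier_burnside_semiring)
  show "x \<oplus>\<^bsub>?M\<^esub> y \<in> carrier ?M" "x \<otimes>\<^bsub>?M\<^esub> y \<in> carrier ?M"
    using X Y by (simp_all add: add_gset_class mult_gset_class gset_class_closed
      gset_sum_closed gset_prod_closed)
  show "class_mark H (x \<oplus>\<^bsub>?M\<^esub> y) = class_mark H x + class_mark H y"
    "class_mark H (x \<otimes>\<^bsub>?M\<^esub> y) = class_mark H x * class_mark H y" if "H \<in> {H. subgroup H G}" for H
    using that X Y by (simp_all add: add_gset_class mult_gset_class class_mark_gset_class
      gset_sum_closed gset_prod_closed mark_gset_sum mark_gset_prod finite_gsetsD)
  show "x = y" if "\<And>H. H \<in> {H. subgroup H G} \<Longrightarrow> class_mark H x = class_mark H y"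
    using that X Y by (simp add: class_mark_gset_class gset_class_eq_iff)
qed

section \<open>Automorphisms acting on the Burnside ring\<close>

context finite_group
begin

abbreviation burnside_mark :: "'g set \<Rightarrow> 'g burnside \<Rightarrow> int" where
  "burnside_mark \<equiv> burnside.grothendieck_mark"

lemma auto_inv_into:
  assumes "\<alpha> \<in> auto G"
  shows "restrict (inv_into (carrier G) \<alpha>) (carrier G) \<in> auto G"
  using assms restrict_inv_into_hom restrict_inv_into_Bij unfolding auto_def by blast

lemma inv_into_auto_closed:
  "\<lbrakk>\<alpha> \<in> auto G; g \<in> carrier G\<rbrakk> \<Longrightarrow> inv_into (carrier G) \<alpha> g \<in> carrier G"
  by (auto simp: auto_def intro: Bij_inv_into_mem)

lemma subgroup_inv_into_image:
  assumes \<alpha>: "\<alpha> \<in> auto G" and H: "subgroup H G"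
  shows "subgroup (inv_into (carrier G) \<alpha> ` H) G"
proof -
  interpret h: group_hom G G "restrict (inv_into (carrier G) \<alpha>) (carrier G)"
    using auto_inv_into[OF \<alpha>]
    by (auto simp: auto_def intro!: group_hom.intro group_hom_axioms.intro group_axioms)
  have "restrict (inv_into (carrier G) \<alpha>) (carrier G) ` H = inv_into (carrier G) \<alpha> ` H"
    using subgroup.subset[OF H] by (intro image_cong) auto
  then show ?thesis
    using h.subgroup_img_is_subgroup[OF H] by simp
qed

lemma gset_twist_closed:
  assumes \<alpha>: "\<alpha> \<in> auto G" and X: "X \<in> finite_gsets G"
  shows "gset_twist G \<alpha> X \<in> finite_gsets G"
proof -
  note D = acts_onD[OF finite_gsetsD(2)[OF X]]
  let ?i = "inv_into (carrier G) \<alpha>"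
  have hom: "restrict ?i (carrier G) \<in> hom G G"
    using auto_inv_into[OF \<alpha>] by (simp add: auto_def)
  have "?i (g \<otimes> h) = ?i g \<otimes> ?i h" if "g \<in> carrier G" "h \<in> carrier G" for g h
    using hom_mult[OF hom that] that by simp
  moreover have "?i \<one> = \<one>"
    using hom_one[OF hom] group_axioms by simp
  ultimately have "acts_on G (\<lambda>g. snd X (?i g)) (fst X)"
    using D inv_into_auto_closed[OF \<alpha>] by (simp add: acts_on_def)
  then show ?thesis
    using finite_gsetsD[OF X] inv_into_auto_closed[OF \<alpha>]
    by (simp add: finite_gsets_def gset_twist_def group_action_iff_acts_on)
qed

lemma mark_gset_twist: "mark H (gset_twist G \<alpha> X) = mark (inv_into (carrier G) \<alpha> ` H) X"
  by (simp add: mark_def gset_twist_def)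

lemma twist_class:
  assumes \<alpha>: "\<alpha> \<in> auto G" and X: "X \<in> finite_gsets G"
  shows "(\<Union>Y\<in>gset_class G X. gset_class G (gset_twist G \<alpha> Y)) = gset_class G (gset_twist G \<alpha> X)"
proof (rule UN_gset_class[OF X])
  fix Y :: "('g, nat) gset"
  assume "Y \<in> finite_gsets G" "\<forall>H. subgroup H G \<longrightarrow> mark H Y = mark H X"
  then show "gset_class G (gset_twist G \<alpha> Y) = gset_class G (gset_twist G \<alpha> X)"
    using X \<alpha> by (subst gset_class_eq_iff)
      (simp_all add: gset_twist_closed mark_gset_twist subgroup_inv_into_image)
qed

text \<open>In the twisted G-set the fixed points of \<open>H\<close> are the old fixed points of
  the preimage of \<open>H\<close>. The later properties of the action are read off from this
  formula.\<close>

lemma aut_act_marks: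
  assumes \<alpha>: "\<alpha> \<in> auto G" and a: "a \<in> carrier (burnside_ring G)"
  shows "aut_act G \<alpha> a \<in> carrier (burnside_ring G)"
    and "subgroup H G \<Longrightarrow>
      burnside_mark H (aut_act G \<alpha> a) = burnside_mark (inv_into (carrier G) \<alpha> ` H) a"
proof -
  let ?h = "\<lambda>c. \<Union>X\<in>c. gset_class G (gset_twist G \<alpha> X)"
  have closed: "?h c \<in> carrier (burnside_semiring G)" if "c \<in> carrier (burnside_semiring G)" for c
    using that by (auto simp: carrier_burnside_semiring twist_class \<alpha>
      gset_class_closed[unfolded carrier_burnside_semiring] gset_twist_closed)
  have marks: "class_mark H (?h c) = class_mark (inv_into (carrier G) \<alpha> ` H) c"
    if "subgroup H G" "c \<in> carrier (burnside_semiring G)" for H c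
    using that by (auto simp: carrier_burnside_semiring twist_class \<alpha> class_mark_gset_class
      gset_twist_closed mark_gset_twist subgroup_inv_into_image)
  have "aut_act G \<alpha> a = grothendieck_map (burnside_semiring G) ?h a"
    by (simp add: aut_act_def)
  then show "aut_act G \<alpha> a \<in> carrier (burnside_ring G)"
    "subgroup H G \<Longrightarrow>
      burnside_mark H (aut_act G \<alpha> a) = burnside_mark (inv_into (carrier G) \<alpha> ` H) a"
    using burnside.grothendieck_map[of ?h "\<lambda>H. inv_into (carrier G) \<alpha> ` H" a] closed marks a
      subgroup_inv_into_image[OF \<alpha>] by (simp_all add: burnside_ring_def)
qed

lemma burnside_mark_inject:
  assumes "a \<in> carrier (burnside_ring G)" "b \<in> carrier (burnside_ring G)"
    and "\<And>H. subgroup H G \<Longrightarrow> burnside_mark H a = burnside_mark H b"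
  shows "a = b"
  using burnside.grothendieck_mark_inject[of a b] assms by (simp add: burnside_ring_def)

lemma comm_monoid_burnside_ring: "comm_monoid (burnside_ring G)"
  unfolding burnside_ring_def by (rule burnside.comm_monoid_grothendieck)

lemma aut_act_mult:
  assumes "\<alpha> \<in> auto G" "a \<in> carrier (burnside_ring G)" "b \<in> carrier (burnside_ring G)"
  shows "aut_act G \<alpha> (a \<otimes>\<^bsub>burnside_ring G\<^esub> b) = aut_act G \<alpha> a \<otimes>\<^bsub>burnside_ring G\<^esub> aut_act G \<alpha> b"
  using assms aut_act_marks[OF assms(1)] burnside.mult_grothendieck[folded burnside_ring_def]
  by (intro burnside_mark_inject) (simp_all add: subgroup_inv_into_image)

lemma aut_act_one:
  assumes "\<alpha> \<in> auto G"
  shows "aut_act G \<alpha> \<one>\<^bsub>burnside_ring G\<^esub> = \<one>\<^bsub>burnside_ring G\<^esub>"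
  using assms aut_act_marks[OF assms(1)] burnside.one_grothendieck[folded burnside_ring_def]
  by (intro burnside_mark_inject) (simp_all add: subgroup_inv_into_image)

text \<open>Two reversals of order cancel: the inverse of a composite reverses its factors, and so
  does taking marks at preimages. On both sides the preimage under \<alpha> is formed first and the
  one under \<beta> second.\<close>

lemma aut_act_compose:
  assumes \<alpha>: "\<alpha> \<in> auto G" and \<beta>: "\<beta> \<in> auto G" and a: "a \<in> carrier (burnside_ring G)"
  shows "aut_act G (compose (carrier G) \<alpha> \<beta>) a = aut_act G \<alpha> (aut_act G \<beta> a)"
proof (rule burnside_mark_inject)
  let ?C = "carrier G"
  have \<alpha>\<beta>: "compose ?C \<alpha> \<beta> \<in> auto G"
    using \<alpha> \<beta> by (auto simp: auto_def compose_Bij hom_compose dest: Bij_imp_funcset)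
  then show "aut_act G (compose ?C \<alpha> \<beta>) a \<in> carrier (burnside_ring G)"
    "aut_act G \<alpha> (aut_act G \<beta> a) \<in> carrier (burnside_ring G)"
    by (simp_all add: aut_act_marks \<alpha> \<beta> a)
  fix H assume H: "subgroup H G"
  have bij: "bij_betw \<alpha> ?C ?C" "bij_betw \<beta> ?C ?C" "bij_betw (compose ?C \<alpha> \<beta>) ?C ?C"
    using \<alpha> \<beta> \<alpha>\<beta> by (auto simp: auto_def Bij_def)
  have "inv_into ?C (compose ?C \<alpha> \<beta>) h = inv_into ?C \<beta> (inv_into ?C \<alpha> h)" if "h \<in> ?C" for h
  proof (rule inv_into_f_eq)
    show "inj_on (compose ?C \<alpha> \<beta>) ?C"
      using bij(3) by (rule bij_betw_imp_inj_on)
    show "inv_into ?C \<beta> (inv_into ?C \<alpha> h) \<in> ?C"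
      using that by (simp add: inv_into_auto_closed \<alpha> \<beta>)
    then show "compose ?C \<alpha> \<beta> (inv_into ?C \<beta> (inv_into ?C \<alpha> h)) = h"
      using that by (simp add: compose_eq inv_into_auto_closed \<alpha> \<beta>
        bij_betw_inv_into_right[OF bij(1)] bij_betw_inv_into_right[OF bij(2)])
  qed
  then have "inv_into ?C (compose ?C \<alpha> \<beta>) ` H = inv_into ?C \<beta> ` inv_into ?C \<alpha> ` H"
    using subgroup.subset[OF H] by (auto simp: image_image subset_eq intro!: image_cong)
  then show "burnside_mark H (aut_act G (compose ?C \<alpha> \<beta>) a) =
      burnside_mark H (aut_act G \<alpha> (aut_act G \<beta> a))"
    by (simp add: aut_act_marks \<alpha> \<beta> \<alpha>\<beta> a H subgroup_inv_into_image)
qed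

section \<open>Inner automorphisms\<close>

lemma conjugation_auto:
  assumes g: "g \<in> carrier G"
  shows "(\<lambda>x\<in>carrier G. g \<otimes> x \<otimes> inv g) \<in> auto G"
    and "x \<in> carrier G \<Longrightarrow>
      inv_into (carrier G) (\<lambda>x\<in>carrier G. g \<otimes> x \<otimes> inv g) x = inv g \<otimes> x \<otimes> g"
proof -
  let ?c = "\<lambda>x\<in>carrier G. g \<otimes> x \<otimes> inv g"
  have cancel: "inv g \<otimes> (g \<otimes> z) = z" "g \<otimes> (inv g \<otimes> z) = z" if "z \<in> carrier G" for z
    using g that by (simp_all flip: m_assoc)
  have right: "?c (inv g \<otimes> x \<otimes> g) = x" and left: "inv g \<otimes> ?c x \<otimes> g = x" if "x \<in> carrier G" for x
    using g that by (simp_all add: m_assoc cancel)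
  have bij: "bij_betw ?c (carrier G) (carrier G)"
    by (rule bij_betwI[where g = "\<lambda>x. inv g \<otimes> x \<otimes> g"]) (use g left right in auto)
  moreover have "?c \<in> hom G G"
  proof (rule homI)
    fix x y assume xy: "x \<in> carrier G" "y \<in> carrier G"
    then show "?c (x \<otimes> y) = ?c x \<otimes> ?c y"
      using g by (simp add: m_assoc cancel)
  qed (use g in simp)
  ultimately show "?c \<in> auto G"
    by (simp add: auto_def Bij_def)
  show "inv_into (carrier G) ?c x = inv g \<otimes> x \<otimes> g" if "x \<in> carrier G"
    by (rule inv_into_f_eq) (use bij right g that in \<open>auto dest: bij_betw_imp_inj_on\<close>)
qed

text \<open>Acting by \<open>inv g\<close> is an isomorphism from \<open>X\<close> onto its twist by
  conjugation with \<open>g\<close>.\<close>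

lemma mark_conjugation:
  assumes g: "g \<in> carrier G" and X: "X \<in> finite_gsets G" and H: "subgroup H G"
  shows "mark H (gset_twist G (\<lambda>x\<in>carrier G. g \<otimes> x \<otimes> inv g) X) = mark H X"
proof -
  note D = acts_onD[OF finite_gsetsD(2)[OF X]]
  have "bij_betw (snd X (inv g)) (fst X) (fst X)"
    by (rule bij_betwI[where g = "snd X g"]) (use D g in auto)
  moreover have "snd X (inv g) (snd X h x) = snd X (inv g \<otimes> h \<otimes> g) (snd X (inv g) x)"
    if "h \<in> carrier G" "x \<in> fst X" for h x
  proof -
    have "inv g \<otimes> h \<otimes> g \<otimes> inv g = inv g \<otimes> h"
      using g that by (simp add: m_assoc)
    then show ?thesis
      using D(3)[of "inv g \<otimes> h \<otimes> g" "inv g" x] D(3)[of "inv g" h x] g that by simp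
  qed
  ultimately have "gset_iso G X (gset_twist G (\<lambda>x\<in>carrier G. g \<otimes> x \<otimes> inv g) X)"
    unfolding gset_iso_def gset_twist_def using conjugation_auto(2)[OF g]
    by (intro exI[of _ "snd X (inv g)"]) simp
  then show ?thesis
    using mark_eq_if_gset_iso finite_gsetsD(2)[OF X] subgroup.subset[OF H] by metis
qed

lemma aut_act_inner:
  assumes \<iota>: "\<iota> \<in> conj_homs G (carrier G) (carrier G)" and a: "a \<in> carrier (burnside_ring G)"
  shows "\<iota> \<in> auto G" "aut_act G \<iota> a = a"
proof -
  obtain g where g: "g \<in> carrier G" "\<iota> = (\<lambda>x\<in>carrier G. g \<otimes> x \<otimes> inv g)"
    using \<iota> by (auto simp: conj_homs_def)
  then show \<iota>_auto: "\<iota> \<in> auto G"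
    using conjugation_auto by simp
  obtain x y where x: "x \<in> carrier (burnside_semiring G)" and y: "y \<in> carrier (burnside_semiring G)"
    and axy: "a = burnside.diff x y"
    using burnside.grothendieck_cases a unfolding burnside_ring_def .
  \<comment> \<open>Read backwards, \<open>mark_gset_twist\<close> turns the mark at the image of
    \<open>H\<close> into a mark at \<open>H\<close> of the twisted G-set, to which
    \<open>mark_conjugation\<close> applies.\<close>
  have "class_mark (inv_into (carrier G) \<iota> ` H) c = class_mark H c"
    if "c \<in> carrier (burnside_semiring G)" "subgroup H G" for c H
    using that mark_conjugation[OF g(1)] subgroup_inv_into_image[OF \<iota>_auto]
    by (auto simp: carrier_burnside_semiring class_mark_gset_class g(2) simp flip: mark_gset_twist)
  then have "burnside_mark (inv_into (carrier G) \<iota> ` H) a = burnside_mark H a"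
    if "subgroup H G" for H
    using that x y subgroup_inv_into_image[OF \<iota>_auto]
    by (simp add: axy burnside.grothendieck_mark_diff)
  then show "aut_act G \<iota> a = a"
    by (intro burnside_mark_inject) (simp_all add: aut_act_marks \<iota>_auto a)
qed

lemma aut_act_Units:
  assumes \<alpha>: "\<alpha> \<in> auto G" and u: "u \<in> Units (burnside_ring G)"
  shows "aut_act G \<alpha> u \<in> Units (burnside_ring G)"
proof -
  obtain v where v: "u \<in> carrier (burnside_ring G)" "v \<in> carrier (burnside_ring G)"
    "v \<otimes>\<^bsub>burnside_ring G\<^esub> u = \<one>\<^bsub>burnside_ring G\<^esub>" "u \<otimes>\<^bsub>burnside_ring G\<^esub> v = \<one>\<^bsub>burnside_ring G\<^esub>"
    using u by (auto simp: Units_def)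
  have "aut_act G \<alpha> v \<otimes>\<^bsub>burnside_ring G\<^esub> aut_act G \<alpha> u = \<one>\<^bsub>burnside_ring G\<^esub>"
    "aut_act G \<alpha> u \<otimes>\<^bsub>burnside_ring G\<^esub> aut_act G \<alpha> v = \<one>\<^bsub>burnside_ring G\<^esub>"
    using v aut_act_mult[OF \<alpha>] aut_act_one[OF \<alpha>] by metis+
  then show ?thesis
    using v aut_act_marks(1)[OF \<alpha>] unfolding Units_def by blast
qed

end

section \<open>The trace for a subgroup of odd index\<close>

text \<open>A finite group acts on an elementary abelian 2-group. In the application
  \<open>U\<close> consists of the units of B(P), \<open>A\<close> is Out_F(P) and \<open>D\<close>
  is Out_S(P).\<close>

locale odd_index_action = U: comm_group U + A: group A
  for U :: "('u, 'm) monoid_scheme" and A :: "('c, 'n) monoid_scheme" +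
  fixes D :: "'c set" and T :: "'c set" and act :: "'c \<Rightarrow> 'u \<Rightarrow> 'u"
  assumes square: "u \<in> carrier U \<Longrightarrow> u \<otimes>\<^bsub>U\<^esub> u = \<one>\<^bsub>U\<^esub>"
    and finite_A: "finite (carrier A)"
    and D: "subgroup D A"
    and index: "odd (card (lcosets\<^bsub>A\<^esub> D))"
    and transversal: "left_transversal A D T"
    and act_closed: "\<lbrakk>c \<in> carrier A; u \<in> carrier U\<rbrakk> \<Longrightarrow> act c u \<in> carrier U"
    and act_mult: "\<lbrakk>c \<in> carrier A; u \<in> carrier U; v \<in> carrier U\<rbrakk> \<Longrightarrow>
      act c (u \<otimes>\<^bsub>U\<^esub> v) = act c u \<otimes>\<^bsub>U\<^esub> act c v"
    and act_act: "\<lbrakk>c \<in> carrier A; d \<in> carrier A; u \<in> carrier U\<rbrakk> \<Longrightarrow>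
      act (c \<otimes>\<^bsub>A\<^esub> d) u = act c (act d u)"
begin

definition fixed :: "'c set \<Rightarrow> 'u set" where
  "fixed B = {u \<in> carrier U. \<forall>c\<in>B. act c u = u}"

definition tr :: "'u \<Rightarrow> 'u" where
  "tr b = (\<Otimes>\<^bsub>U\<^esub>c\<in>T. act c b)"

lemma inv_eq: "u \<in> carrier U \<Longrightarrow> inv\<^bsub>U\<^esub> u = u"
  using square by (simp add: U.inv_equality)

text \<open>The image of the identity equals its own square, and squares are trivial in
  \<open>U\<close>.\<close>

lemma act_one: "c \<in> carrier A \<Longrightarrow> act c \<one>\<^bsub>U\<^esub> = \<one>\<^bsub>U\<^esub>"
  using act_mult[of c "\<one>\<^bsub>U\<^esub>" "\<one>\<^bsub>U\<^esub>"] act_closed[of c "\<one>\<^bsub>U\<^esub>"] square by simp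

lemma act_finprod:
  assumes "c \<in> carrier A" "f \<in> B \<rightarrow> carrier U"
  shows "act c (finprod U f B) = (\<Otimes>\<^bsub>U\<^esub>b\<in>B. act c (f b))"
  using assms(2)
proof (induction B rule: infinite_finite_induct)
  case (insert x F)
  then show ?case
    using assms(1) by (simp add: act_mult act_closed Pi_def)
\<comment> \<open>For an infinite index set, as for the empty one, both products are the
  identity.\<close>
qed (use assms(1) act_one in auto)

lemma subgroup_fixed:
  assumes "B \<subseteq> carrier A"
  shows "subgroup (fixed B) U"
proof
  show "\<one>\<^bsub>U\<^esub> \<in> fixed B"
    using assms act_one by (auto simp: fixed_def)
qed (use assms in \<open>auto simp: fixed_def act_mult subset_iff inv_eq\<close>)

lemma T_subset: "T \<subseteq> carrier A"
  using transversal by (simp add: left_transversal_def)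

lemma finite_T: "finite T"
  using T_subset finite_A by (rule finite_subset)

lemma transversal_ex1: "c \<in> carrier A \<Longrightarrow> \<exists>!t. t \<in> T \<and> t \<in> c <#\<^bsub>A\<^esub> D"
  using transversal by (auto simp: left_transversal_def LCOSETS_def)

lemma l_coset_eq:
  assumes "c \<in> carrier A" "t \<in> c <#\<^bsub>A\<^esub> D"
  shows "t <#\<^bsub>A\<^esub> D = c <#\<^bsub>A\<^esub> D"
  using A.l_repr_independence[OF assms(2,1) D] by simp

text \<open>Forming cosets is a bijection from \<open>T\<close> onto the left cosets of
  \<open>D\<close>, so the trace has an odd number of factors.\<close>

lemma odd_card_T: "odd (card T)"
proof -
  have "bij_betw (\<lambda>t. t <#\<^bsub>A\<^esub> D) T (lcosets\<^bsub>A\<^esub> D)"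
  proof (rule bij_betw_imageI)
    show "inj_on (\<lambda>t. t <#\<^bsub>A\<^esub> D) T"
    proof (rule inj_onI)
      fix s t assume st: "s \<in> T" "t \<in> T" "s <#\<^bsub>A\<^esub> D = t <#\<^bsub>A\<^esub> D"
      then have "s \<in> s <#\<^bsub>A\<^esub> D" "t \<in> s <#\<^bsub>A\<^esub> D" "s \<in> carrier A"
        using T_subset A.lcos_self[OF _ D] by blast+
      then show "s = t"
        using transversal_ex1 st by blast
    qed
    have "c <#\<^bsub>A\<^esub> D \<in> (\<lambda>t. t <#\<^bsub>A\<^esub> D) ` T" if c: "c \<in> carrier A" for c
      using transversal_ex1[OF c] l_coset_eq[OF c] by (metis imageI)
    then show "(\<lambda>t. t <#\<^bsub>A\<^esub> D) ` T = lcosets\<^bsub>A\<^esub> D"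
      using T_subset by (auto simp: LCOSETS_def)
  qed
  then show ?thesis
    using index bij_betw_same_card by metis
qed

lemma tr_fixed:
  assumes b: "b \<in> fixed (carrier A)"
  shows "tr b = b"
proof -
  have bU: "b \<in> carrier U"
    using b by (simp add: fixed_def)
  have "tr b = (\<Otimes>\<^bsub>U\<^esub>c\<in>T. b)"
    unfolding tr_def using b T_subset bU by (intro U.finprod_cong') (auto simp: fixed_def)
  also have "\<dots> = b [^]\<^bsub>U\<^esub> card T"
    using bU by (rule U.finprod_const)
  also obtain k where "card T = Suc (2 * k)"
    using odd_card_T by (auto elim: oddE)
  then have "b [^]\<^bsub>U\<^esub> card T = (b [^]\<^bsub>U\<^esub> (2::nat)) [^]\<^bsub>U\<^esub> k \<otimes>\<^bsub>U\<^esub> b"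
    using bU by (simp add: U.nat_pow_pow)
  also have "b [^]\<^bsub>U\<^esub> (2::nat) = \<one>\<^bsub>U\<^esub>"
    using square[OF bU] bU by (simp add: numeral_2_eq_2)
  finally show ?thesis
    using bU by simp
qed

text \<open>For a \<open>D\<close>-fixed \<open>b\<close> the factor \<open>act t b\<close> depends only on the left coset of \<open>t\<close>, and
  multiplication by \<open>c\<close> permutes these cosets.\<close>

lemma act_tr:
  assumes b: "b \<in> fixed D" and c: "c \<in> carrier A"
  shows "act c (tr b) = tr b"
proof -
  have bU: "b \<in> carrier U"
    using b by (simp add: fixed_def)
  have TA: "t \<in> carrier A" if "t \<in> T" for t
    using that T_subset by blast
  have factors: "(\<lambda>t. act t b) \<in> T \<rightarrow> carrier U"
    using TA act_closed bU by auto
  \<comment> \<open>The permutation of \<open>T\<close> induced by \<open>c\<close>: each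
    \<open>t\<close> goes to the chosen representative of the coset of \<open>c t\<close>.\<close>
  define \<sigma> where "\<sigma> t = (THE s. s \<in> T \<and> s \<in> (c \<otimes>\<^bsub>A\<^esub> t) <#\<^bsub>A\<^esub> D)" for t
  have \<sigma>: "\<sigma> t \<in> T" "\<sigma> t \<in> (c \<otimes>\<^bsub>A\<^esub> t) <#\<^bsub>A\<^esub> D" if "t \<in> T" for t
    using theI'[OF transversal_ex1[of "c \<otimes>\<^bsub>A\<^esub> t"]] TA[OF that] c unfolding \<sigma>_def by auto
  have act_\<sigma>: "act c (act t b) = act (\<sigma> t) b" if t: "t \<in> T" for t
  proof -
    \<comment> \<open>The representative differs from \<open>c t\<close> by a right factor
      \<open>d\<close> in \<open>D\<close>, which acts first and fixes \<open>b\<close>.\<close>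
    obtain d where d: "d \<in> D" "\<sigma> t = c \<otimes>\<^bsub>A\<^esub> t \<otimes>\<^bsub>A\<^esub> d"
      using \<sigma>(2)[OF t] by (auto simp: l_coset_def)
    then have "act (\<sigma> t) b = act (c \<otimes>\<^bsub>A\<^esub> t) (act d b)"
      using subgroup.mem_carrier[OF D] c TA[OF t] bU by (simp add: act_act)
    then show ?thesis
      using d(1) b c TA[OF t] bU by (simp add: fixed_def act_act)
  qed
  have "inj_on \<sigma> T"
  proof (rule inj_onI)
    fix s t assume st: "s \<in> T" "t \<in> T" "\<sigma> s = \<sigma> t"
    have "(c \<otimes>\<^bsub>A\<^esub> r) <#\<^bsub>A\<^esub> D = c <#\<^bsub>A\<^esub> (r <#\<^bsub>A\<^esub> D)" if "r \<in> T" for r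
      using TA[OF that] c subgroup.subset[OF D] by (simp add: A.lcos_m_assoc)
    then have "c <#\<^bsub>A\<^esub> (s <#\<^bsub>A\<^esub> D) = c <#\<^bsub>A\<^esub> (t <#\<^bsub>A\<^esub> D)"
      using l_coset_eq[OF _ \<sigma>(2)[OF st(1)]] l_coset_eq[OF _ \<sigma>(2)[OF st(2)]] st TA c by simp
    \<comment> \<open>Cancelling \<open>c\<close> shows that \<open>s\<close> and \<open>t\<close>
      lie in the same coset, and the transversal meets each coset only once.\<close>
    then have "inv\<^bsub>A\<^esub> c <#\<^bsub>A\<^esub> (c <#\<^bsub>A\<^esub> (s <#\<^bsub>A\<^esub> D)) = inv\<^bsub>A\<^esub> c <#\<^bsub>A\<^esub> (c <#\<^bsub>A\<^esub> (t <#\<^bsub>A\<^esub> D))"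
      by simp
    moreover have "inv\<^bsub>A\<^esub> c <#\<^bsub>A\<^esub> (c <#\<^bsub>A\<^esub> (r <#\<^bsub>A\<^esub> D)) = r <#\<^bsub>A\<^esub> D" if "r \<in> T" for r
      using c TA[OF that] subgroup.subset[OF D]
      by (simp add: A.lcos_m_assoc A.l_coset_subset_G flip: A.m_assoc)
    ultimately have "s <#\<^bsub>A\<^esub> D = t <#\<^bsub>A\<^esub> D"
      using st by simp
    then show "s = t"
      using transversal_ex1[OF TA[OF st(1)]] A.lcos_self[OF _ D] TA st by metis
  qed
  then have "\<sigma> ` T = T"
    using \<sigma>(1) finite_T by (intro endo_inj_surj) auto
  have "act c (tr b) = (\<Otimes>\<^bsub>U\<^esub>t\<in>T. act (\<sigma> t) b)"
    unfolding tr_def act_finprod[OF c factors]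
    using \<sigma>(1) factors act_\<sigma> by (intro U.finprod_cong') auto
  also have "\<dots> = (\<Otimes>\<^bsub>U\<^esub>t\<in>\<sigma> ` T. act t b)"
    using \<open>inj_on \<sigma> T\<close> \<open>\<sigma> ` T = T\<close> factors by (subst U.finprod_reindex) auto
  finally show ?thesis
    using \<open>\<sigma> ` T = T\<close> by (simp add: tr_def)
qed

lemma tr_closed: "b \<in> fixed D \<Longrightarrow> tr b \<in> fixed (carrier A)"
  using T_subset by (auto simp: act_tr fixed_def[of "carrier A"])
    (auto simp: tr_def fixed_def intro!: U.finprod_closed act_closed)

lemma fixed_antimono: "fixed (carrier A) \<subseteq> fixed D"
  using subgroup.subset[OF D] by (auto simp: fixed_def)

lemma tr_mult:
  assumes "a \<in> carrier U" "b \<in> carrier U"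
  shows "tr (a \<otimes>\<^bsub>U\<^esub> b) = tr a \<otimes>\<^bsub>U\<^esub> tr b"
proof -
  have "tr (a \<otimes>\<^bsub>U\<^esub> b) = (\<Otimes>\<^bsub>U\<^esub>c\<in>T. act c a \<otimes>\<^bsub>U\<^esub> act c b)"
    unfolding tr_def using assms T_subset
    by (intro U.finprod_cong') (auto simp: act_mult act_closed subset_iff)
  also have "\<dots> = tr a \<otimes>\<^bsub>U\<^esub> tr b"
    unfolding tr_def using assms T_subset by (intro U.finprod_multf) (auto simp: act_closed subset_iff)
  finally show ?thesis .
qed

theorem split_surjective_tr:
  "split_surjective (U\<lparr>carrier := fixed D\<rparr>) (U\<lparr>carrier := fixed (carrier A)\<rparr>) tr"
proof -
  have "fixed D \<subseteq> carrier U"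
    by (auto simp: fixed_def)
  then have "tr \<in> hom (U\<lparr>carrier := fixed D\<rparr>) (U\<lparr>carrier := fixed (carrier A)\<rparr>)"
    by (auto simp: hom_def tr_closed tr_mult subset_iff)
  moreover have "tr ` fixed D = fixed (carrier A)"
    using tr_closed tr_fixed fixed_antimono by (force simp: image_def)
  moreover have "(\<lambda>x. x) \<in> hom (U\<lparr>carrier := fixed (carrier A)\<rparr>) (U\<lparr>carrier := fixed D\<rparr>)"
    using fixed_antimono by (auto simp: hom_def)
  ultimately show ?thesis
    by (auto simp: split_surjective_def epi_def tr_fixed intro!: bexI[of _ "\<lambda>x. x"])
qed

text \<open>Being the identity on its image, \<open>tr\<close> is a projection: \<open>b\<close> is
  the product of \<open>b * tr b\<close> and \<open>tr b\<close>. The first factor lies in the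
  kernel because its trace is the square of \<open>tr b\<close>.\<close>

theorem internal_direct_product_tr:
  "internal_direct_product (U\<lparr>carrier := fixed D\<rparr>)
     (kernel (U\<lparr>carrier := fixed D\<rparr>) (U\<lparr>carrier := fixed (carrier A)\<rparr>) tr) (fixed (carrier A))"
    (is "internal_direct_product ?US ?K ?F")
proof -
  have DU: "subgroup (fixed D) U" and FU: "subgroup (fixed (carrier A)) U"
    using subgroup_fixed subgroup.subset[OF D] by auto
  interpret US: comm_group ?US
    by (rule group.group_comm_groupI[OF U.subgroup_imp_group[OF DU]])
      (auto simp: fixed_def U.m_comm)
  interpret h: group_hom ?US "U\<lparr>carrier := ?F\<rparr>" tr
    using split_surjective_tr U.subgroup_imp_group[OF FU]
    by (auto simp: split_surjective_def epi_def intro!: group_hom.intro group_hom_axioms.intro US.group_axioms)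
  have "?K \<lhd> ?US"
    by (rule US.subgroup_imp_normal[OF h.subgroup_kernel])
  moreover have "?F \<lhd> ?US"
    using U.subgroup_incl[OF FU DU fixed_antimono] by (rule US.subgroup_imp_normal)
  \<comment> \<open>An element of both subgroups equals its own trace, and that trace is the
    identity.\<close>
  moreover have "?K \<inter> ?F = {\<one>\<^bsub>?US\<^esub>}"
    using subgroup.one_closed[OF FU] fixed_antimono tr_fixed by (auto simp: kernel_def)
  moreover have "?K <#>\<^bsub>?US\<^esub> ?F = carrier ?US"
  proof
    show "?K <#>\<^bsub>?US\<^esub> ?F \<subseteq> carrier ?US"
      using fixed_antimono by (intro US.set_mult_closed) (auto simp: kernel_def)
    show "carrier ?US \<subseteq> ?K <#>\<^bsub>?US\<^esub> ?F"
    proof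
      fix b assume "b \<in> carrier ?US"
      then have b: "b \<in> fixed D" "tr b \<in> fixed D" "b \<in> carrier U" "tr b \<in> carrier U"
        "tr b \<in> fixed (carrier A)"
        using fixed_antimono tr_closed by (auto simp: fixed_def)
      then have "tr (b \<otimes>\<^bsub>U\<^esub> tr b) = \<one>\<^bsub>U\<^esub>"
        by (simp add: tr_mult tr_fixed square)
      then have "b \<otimes>\<^bsub>U\<^esub> tr b \<in> ?K"
        using b subgroup.m_closed[OF DU] by (simp add: kernel_def)
      moreover have "b = b \<otimes>\<^bsub>U\<^esub> tr b \<otimes>\<^bsub>?US\<^esub> tr b"
        using b by (simp add: U.m_assoc square)
      ultimately show "b \<in> ?K <#>\<^bsub>?US\<^esub> ?F"
        using b(5) unfolding set_mult_def by blast
    qed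
  qed
  ultimately show ?thesis
    by (simp add: internal_direct_product_def)
qed

end

section \<open>Automorphisms in a fusion system\<close>

context fusion_system
begin

text \<open>An infinite carrier would have order 0, which is not a power of a prime.\<close>

lemma finite_S: "finite (carrier S)"
  using order_S prime_p by (metis card_ge_0_finite order_def prime_gt_0_nat zero_less_power)

text \<open>Morphisms from \<open>P\<close> to itself are injective and \<open>P\<close> is finite,
  so they are automorphisms. That their inverses are again morphisms comes from the factorization
  axiom.\<close>

lemma subgroup_F_auto:
  assumes P: "subgroup P S"
  shows "subgroup (F P P) (AutoGroup (S\<lparr>carrier := P\<rparr>))"
proof -
  let ?P = "S\<lparr>carrier := P\<rparr>"
  interpret P: group ?P
    by (rule subgroup_imp_group[OF P])
  interpret Aut: group "AutoGroup ?P"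
    by (rule P.AutoGroup)
  have "finite P"
    using finite_S subgroup.subset[OF P] finite_subset by blast
  have auto: "\<phi> \<in> auto ?P" if "\<phi> \<in> F P P" for \<phi>
  proof -
    have \<phi>: "\<phi> \<in> hom ?P ?P" "inj_on \<phi> P" "\<phi> \<in> extensional P"
      using hom_mono[OF P P] that by (auto simp: mon_def)
    then have "\<phi> ` P \<subseteq> P"
      by (auto simp: hom_def)
    then have "\<phi> ` P = P"
      using \<open>finite P\<close> \<phi>(2) endo_inj_surj by blast
    then show ?thesis
      using \<phi> by (simp add: auto_def Bij_def bij_betw_def)
  qed
  have mult: "\<alpha> \<otimes>\<^bsub>AutoGroup ?P\<^esub> \<beta> = compose P \<alpha> \<beta>" if "\<alpha> \<in> auto ?P" "\<beta> \<in> auto ?P" for \<alpha> \<beta>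
    using that by (auto simp: AutoGroup_def BijGroup_def auto_def)
  show ?thesis
  proof (rule Aut.subgroupI)
    show "F P P \<subseteq> carrier (AutoGroup ?P)"
      using auto by (auto simp: AutoGroup_def)
    have "(\<lambda>x\<in>P. x) \<in> conj_homs S P P"
      using subgroup.subset[OF P] by (auto simp: conj_homs_def subset_iff intro!: exI[of _ \<one>] restrict_ext)
    then show "F P P \<noteq> {}"
      using conj_homs_subset[OF P P] by blast
    show "\<alpha> \<otimes>\<^bsub>AutoGroup ?P\<^esub> \<beta> \<in> F P P" if "\<alpha> \<in> F P P" "\<beta> \<in> F P P" for \<alpha> \<beta>
      using that comp_closed[OF P P P] by (simp add: mult auto)
    show "inv\<^bsub>AutoGroup ?P\<^esub> \<alpha> \<in> F P P" if \<alpha>: "\<alpha> \<in> F P P" for \<alpha>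
    proof -
      \<comment> \<open>Since \<alpha> maps onto \<open>P\<close>, the intermediate group
        \<open>R\<close> must be \<open>P\<close> itself; then \<alpha> is the isomorphism \<psi>,
        whose inverse lies in \<open>F P P\<close>.\<close>
      obtain R \<psi> where R: "subgroup R S" "R \<subseteq> P" and \<psi>: "\<psi> \<in> fusion_isos F P R"
        and \<alpha>\<psi>: "\<alpha> = compose P (\<lambda>x\<in>R. x) \<psi>"
        using iso_incl_factorization[OF P P \<alpha>] by blast
      have \<psi>': "\<psi> \<in> hom ?P (S\<lparr>carrier := R\<rparr>)" "\<psi> \<in> extensional P"
        using \<psi> hom_mono[OF P R(1)] by (auto simp: fusion_isos_def mon_def)
      then have "\<psi> ` P \<subseteq> R"
        by (auto simp: hom_def)
      then have "\<alpha> = \<psi>"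
        using \<psi>'(2) unfolding \<alpha>\<psi> by (intro extensionalityI[of _ P]) (auto simp: compose_def)
      moreover have "\<alpha> ` P = P"
        using auto[OF \<alpha>] by (auto simp: auto_def Bij_def bij_betw_def)
      ultimately have "R = P"
        using \<open>\<psi> ` P \<subseteq> R\<close> R(2) by simp
      then obtain \<beta> where \<beta>: "\<beta> \<in> F P P" "compose P \<beta> \<alpha> = (\<lambda>x\<in>P. x)"
        using \<psi> \<open>\<alpha> = \<psi>\<close> by (auto simp: fusion_isos_def)
      have "inv\<^bsub>AutoGroup ?P\<^esub> \<alpha> = \<beta>"
        using \<alpha> \<beta> auto[OF \<alpha>] auto[OF \<beta>(1)]
        by (intro Aut.inv_equality) (simp_all add: mult, simp_all add: AutoGroup_def BijGroup_def)
      then show ?thesis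
        using \<beta>(1) by simp
    qed
  qed
qed

lemma group_aut_group: "subgroup P S \<Longrightarrow> group (aut_group S F P)"
  unfolding aut_group_def
  by (intro group.subgroup_imp_group group.AutoGroup subgroup_imp_group subgroup_F_auto)

lemma F_subset_auto: "subgroup P S \<Longrightarrow> F P P \<subseteq> auto (S\<lparr>carrier := P\<rparr>)"
  using subgroup.subset[OF subgroup_F_auto] by (simp add: AutoGroup_def)

lemma aut_group_mult:
  assumes "subgroup P S" "\<alpha> \<in> F P P" "\<beta> \<in> F P P"
  shows "\<alpha> \<otimes>\<^bsub>aut_group S F P\<^esub> \<beta> = compose P \<alpha> \<beta>"
  using F_subset_auto[OF assms(1)] assms(2,3)
  by (auto simp: aut_group_def AutoGroup_def BijGroup_def auto_def)

lemma inn_subset: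
  assumes P: "subgroup P S"
  shows "inn S P \<subseteq> conj_homs S P P"
  using subgroup.mem_carrier[OF P] by (auto simp: inn_def conj_homs_def m_inv_consistent[OF P])

text \<open>Conjugating \<open>c g\<close> by an automorphism \<alpha> gives
  \<open>c (\<alpha> g)\<close>.\<close>

lemma inn_normal:
  assumes P: "subgroup P S"
  shows "inn S P \<lhd> aut_group S F P"
proof -
  let ?P = "S\<lparr>carrier := P\<rparr>" and ?A = "aut_group S F P"
  interpret P: group ?P
    by (rule subgroup_imp_group[OF P])
  interpret A: group ?A
    by (rule group_aut_group[OF P])
  define c where "c g = (\<lambda>x\<in>P. g \<otimes> x \<otimes> inv g)" for g
  \<comment> \<open>The definition of \<open>inn\<close> takes inverses in the group
    \<open>P\<close>, while \<open>c\<close> takes them in \<open>S\<close>; the two agree on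
    \<open>P\<close>.\<close>
  have inn: "inn S P = c ` P"
  proof (intro equalityI subsetI)
    fix f assume "f \<in> inn S P"
    then obtain g where "g \<in> P" "f = (\<lambda>x\<in>P. g \<otimes> x \<otimes> inv\<^bsub>?P\<^esub> g)"
      by (auto simp: inn_def conj_homs_def)
    then show "f \<in> c ` P"
      by (simp add: c_def m_inv_consistent[OF P])
  next
    fix f assume "f \<in> c ` P"
    then obtain g where g: "g \<in> P" "f = (\<lambda>x\<in>P. g \<otimes> x \<otimes> inv\<^bsub>?P\<^esub> g)"
      by (auto simp: c_def m_inv_consistent[OF P])
    moreover have "\<forall>x\<in>P. g \<otimes> x \<otimes> inv\<^bsub>?P\<^esub> g \<in> P"
      using g(1) P by (simp add: m_inv_consistent[OF P] subgroup.m_closed subgroup.m_inv_closed)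
    ultimately show "f \<in> inn S P"
      by (auto simp: inn_def conj_homs_def)
  qed
  have carrier: "carrier ?A = F P P"
    by (simp add: aut_group_def)
  have cF: "c g \<in> F P P" if "g \<in> P" for g
    using that inn inn_subset[OF P] conj_homs_subset[OF P P] by blast
  have PS: "x \<in> carrier S" if "x \<in> P" for x
    using that subgroup.mem_carrier[OF P] by blast
  have c_mult: "c g \<otimes>\<^bsub>?A\<^esub> c h = c (g \<otimes> h)" if gh: "g \<in> P" "h \<in> P" for g h
  proof -
    have "compose P (c g) (c h) = c (g \<otimes> h)"
      using gh PS P by (auto simp: c_def compose_def fun_eq_iff m_assoc inv_mult_group
        subgroup.m_closed subgroup.m_inv_closed)
    then show ?thesis
      using aut_group_mult[OF P] cF gh by simp
  qed
  \<comment> \<open>With \<alpha> moved to the right, the conjugation formula becomes an equation of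
    composites that can be checked pointwise.\<close>
  have conj: "\<alpha> \<otimes>\<^bsub>?A\<^esub> c g = c (\<alpha> g) \<otimes>\<^bsub>?A\<^esub> \<alpha>" "\<alpha> g \<in> P" if \<alpha>: "\<alpha> \<in> F P P" and g: "g \<in> P" for \<alpha> g
  proof -
    have hom: "\<alpha> \<in> hom ?P ?P"
      using F_subset_auto[OF P] \<alpha> by (auto simp: auto_def)
    then interpret h: group_hom ?P ?P \<alpha>
      by (intro group_hom.intro group_hom_axioms.intro P.group_axioms)
    have closed: "\<alpha> x \<in> P" if "x \<in> P" for x
      using h.hom_closed that by simp
    show "\<alpha> g \<in> P"
      using closed g .
    have "\<alpha> (g \<otimes> x \<otimes> inv g) = \<alpha> g \<otimes> \<alpha> x \<otimes> inv (\<alpha> g)" if x: "x \<in> P" for x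
      using h.hom_mult[of "g \<otimes> x" "inv g"] h.hom_mult[of g x] h.hom_inv[of g] g x closed P
      by (simp add: m_inv_consistent[OF P] subgroup.m_closed subgroup.m_inv_closed)
    then have "compose P \<alpha> (c g) = compose P (c (\<alpha> g)) \<alpha>"
      using closed g by (auto simp: compose_def c_def fun_eq_iff)
    then show "\<alpha> \<otimes>\<^bsub>?A\<^esub> c g = c (\<alpha> g) \<otimes>\<^bsub>?A\<^esub> \<alpha>"
      using aut_group_mult[OF P] \<alpha> cF g closed by simp
  qed
  have "subgroup (inn S P) ?A"
  proof (rule A.subgroupI)
    show "inn S P \<subseteq> carrier ?A" "inn S P \<noteq> {}"
      using cF subgroup.one_closed[OF P] by (auto simp: inn carrier)
    have c1: "c \<one> = \<one>\<^bsub>?A\<^esub>"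
      using PS by (auto simp: c_def aut_group_def AutoGroup_def BijGroup_def fun_eq_iff)
    show "inv\<^bsub>?A\<^esub> a \<in> inn S P" if "a \<in> inn S P" for a
    proof -
      obtain g where g: "g \<in> P" "a = c g"
        using \<open>a \<in> inn S P\<close> inn by blast
      then have "c (inv g) \<otimes>\<^bsub>?A\<^esub> c g = \<one>\<^bsub>?A\<^esub>"
        using PS P by (simp add: c_mult c1 subgroup.m_inv_closed)
      then have "inv\<^bsub>?A\<^esub> a = c (inv g)"
        using g cF P by (intro A.inv_equality) (auto simp: carrier subgroup.m_inv_closed)
      then show ?thesis
        using g P by (simp add: inn subgroup.m_inv_closed)
    qed
    show "a \<otimes>\<^bsub>?A\<^esub> b \<in> inn S P" if "a \<in> inn S P" "b \<in> inn S P" for a b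
      using that P by (auto simp: inn c_mult subgroup.m_closed)
  qed
  moreover have "\<alpha> \<otimes>\<^bsub>?A\<^esub> a \<otimes>\<^bsub>?A\<^esub> inv\<^bsub>?A\<^esub> \<alpha> \<in> inn S P" if "\<alpha> \<in> carrier ?A" "a \<in> inn S P" for \<alpha> a
  proof -
    obtain g where g: "g \<in> P" "a = c g"
      using \<open>a \<in> inn S P\<close> inn by blast
    then have "\<alpha> \<otimes>\<^bsub>?A\<^esub> a \<otimes>\<^bsub>?A\<^esub> inv\<^bsub>?A\<^esub> \<alpha> = c (\<alpha> g)"
      using conj[OF that(1)[unfolded carrier] g(1)] that(1) A.inv_closed[OF that(1)] cF
      by (simp add: A.m_assoc carrier)
    then show ?thesis
      using conj(2)[OF that(1)[unfolded carrier] g(1)] inn by simp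
  qed
  ultimately show ?thesis
    by (simp add: A.normal_inv_iff)
qed

lemma finite_F: "subgroup P S \<Longrightarrow> finite (F P P)"
proof -
  assume P: "subgroup P S"
  have "finite P"
    using finite_S subgroup.subset[OF P] finite_subset by blast
  moreover have "F P P \<subseteq> P \<rightarrow>\<^sub>E P"
  proof
    fix \<phi> assume "\<phi> \<in> F P P"
    then have "\<phi> \<in> auto (S\<lparr>carrier := P\<rparr>)"
      using F_subset_auto[OF P] by blast
    then show "\<phi> \<in> P \<rightarrow>\<^sub>E P"
      by (auto simp: auto_def Bij_def bij_betw_def PiE_def)
  qed
  ultimately show ?thesis
    using finite_PiE[of P "\<lambda>_. P"] finite_subset by blast
qed

section \<open>Outer automorphism groups and their index\<close>

lemma group_out_group: "subgroup P S \<Longrightarrow> group (out_group S F P)"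
  unfolding out_group_def by (intro normal.factorgroup_is_group inn_normal)

text \<open>Out_S(P) appears as a quotient by the same Inn(P) of a subgroup of Aut_F(P), so its
  elements are literally elements of Out_F(P).\<close>

lemma out_group_conj_homs:
  "out_group S (conj_homs S) P = (aut_group S F P)\<lparr>carrier := conj_homs S P P\<rparr> Mod inn S P"
  by (simp add: out_group_def aut_group_def)

lemma subgroup_out_group:
  assumes P: "subgroup P S" and H: "subgroup (conj_homs S P P) (aut_group S F P)"
  shows "subgroup (carrier (out_group S (conj_homs S) P)) (out_group S F P)"
  using group.normal_subgroup_factorize[OF group_aut_group[OF P] inn_normal[OF P] inn_subset[OF P] H]
  by (simp add: out_group_def FactGroup_def aut_group_def)

text \<open>Dividing by Inn(P), which lies in both groups, preserves the index of Aut_S(P) in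
  Aut_F(P), and the index of a Sylow subgroup is prime to \<open>p\<close>.\<close>

lemma odd_index:
  assumes P: "subgroup P S" and aut: "fully_automized p S F P"
  shows "\<not> p dvd card (lcosets\<^bsub>out_group S F P\<^esub> (carrier (out_group S (conj_homs S) P)))"
    (is "\<not> p dvd ?i")
proof
  let ?A = "aut_group S F P" and ?H = "conj_homs S P P" and ?N = "inn S P"
  let ?D = "carrier (out_group S (conj_homs S) P)"
  interpret A: group ?A
    by (rule group_aut_group[OF P])
  interpret O: group "out_group S F P"
    by (rule group_out_group[OF P])
  have H: "subgroup ?H ?A" and card_H: "card ?H = p ^ multiplicity p (order ?A)"
    using aut by (auto simp: fully_automized_def sylow_subgroup_def)
  interpret H: group "?A\<lparr>carrier := ?H\<rparr>"
    by (rule A.subgroup_imp_group[OF H])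
  have finite_A: "finite (carrier ?A)"
    using finite_F[OF P] by (simp add: aut_group_def)
  have fin_O: "finite (carrier (out_group S F P))"
    using finite_A by (simp add: out_group_def carrier_FactGroup)
  have N: "subgroup ?N ?A"
    using inn_normal[OF P] by (rule normal_imp_subgroup)
  have NH: "subgroup ?N (?A\<lparr>carrier := ?H\<rparr>)"
    using A.subgroup_incl[OF N H inn_subset[OF P]] .
  have "?i * card ?D = order (out_group S F P)"
    using O.l_lagrange[OF fin_O subgroup_out_group[OF P H]] .
  moreover have "order (out_group S F P) * card ?N = order ?A"
    using A.lagrange[OF N] by (simp add: out_group_def FactGroup_def order_def)
  moreover have "card ?D * card ?N = card ?H"
    using H.lagrange[OF NH] by (simp add: out_group_conj_homs FactGroup_def order_def)
  ultimately have eq: "order ?A = ?i * p ^ multiplicity p (order ?A)"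
    using card_H by (metis mult.assoc)
  assume "p dvd ?i"
  then have "p ^ Suc (multiplicity p (order ?A)) dvd order ?A"
    using eq by (metis mult_dvd_mono dvd_refl power_Suc)
  \<comment> \<open>Every power of \<open>p\<close> divides 0, so divisibility bounds the
    multiplicity only for a nonzero order.\<close>
  moreover have "order ?A \<noteq> 0"
    using finite_A A.order_gt_0_iff_finite by auto
  ultimately show False
    using prime_p by (metis Suc_n_not_le_n power_dvd_iff_le_multiplicity not_prime_unit)
qed

end

section \<open>The trace on units of the Burnside ring of P\<close>

theorem proposition6p3:
  fixes S :: "('a, 'm) monoid_scheme" and F :: "'a homsets" and P :: "'a set"
    and T :: "('a \<Rightarrow> 'a) set set"
  assumes "saturated_fusion_system 2 S F"
    and "subgroup P S"
    and "fully_automized 2 S F P"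
    and "left_transversal (out_group S F P) (carrier (out_group S (conj_homs S) P)) T"
  shows "let GP = S\<lparr>carrier := P\<rparr>;
             U_S = fixed_units GP (carrier (out_group S (conj_homs S) P));
             U_F = fixed_units GP (carrier (out_group S F P));
             tr = trace_map GP T
         in split_surjective U_S U_F tr \<and>
            internal_direct_product U_S (kernel U_S U_F tr) (carrier U_F)"
proof -
  interpret F: saturated_fusion_system 2 S F
    by fact
  note P = \<open>subgroup P S\<close>
  let ?P = "S\<lparr>carrier := P\<rparr>" and ?A = "aut_group S F P" and ?O = "out_group S F P"
  let ?R = "burnside_ring ?P" and ?D = "carrier (out_group S (conj_homs S) P)"
  interpret P: group ?P
    by (rule F.subgroup_imp_group[OF P])
  interpret P: finite_group ?P
    using F.finite_S subgroup.subset[OF P] finite_subset by unfold_locales auto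
  interpret R: comm_monoid ?R
    by (rule P.comm_monoid_burnside_ring)
  interpret A: group ?A
    by (rule F.group_aut_group[OF P])
  interpret N: normal "inn S P" ?A
    by (rule F.inn_normal[OF P])
  have carrier_A: "carrier ?A = F P P"
    by (simp add: aut_group_def)
  have H: "subgroup (conj_homs S P P) ?A"
    using assms(3) by (simp add: fully_automized_def sylow_subgroup_def)
  have auto: "\<alpha> \<in> auto ?P" if "\<alpha> \<in> F P P" for \<alpha>
    using that F.F_subset_auto[OF P] by blast
  \<comment> \<open>The representative chosen by \<open>SOME\<close> may be replaced by any \<alpha>
    in the coset, since the two differ by inner automorphisms.\<close>
  have out_act: "\<alpha> \<in> F P P \<and> out_act ?P \<omega> u = aut_act ?P \<alpha> u"
    if \<omega>: "\<omega> \<in> carrier ?O" and \<alpha>: "\<alpha> \<in> \<omega>" and u: "u \<in> carrier ?R" for \<omega> \<alpha> u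
  proof -
    obtain \<phi> where \<phi>: "\<phi> \<in> F P P" "\<omega> = inn S P #>\<^bsub>?A\<^esub> \<phi>"
      using \<omega> by (auto simp: out_group_def carrier_FactGroup carrier_A)
    have act: "\<beta> \<in> F P P \<and> aut_act ?P \<beta> u = aut_act ?P \<phi> u" if \<beta>: "\<beta> \<in> \<omega>" for \<beta>
    proof -
      obtain \<iota> where \<iota>: "\<iota> \<in> inn S P" "\<beta> = \<iota> \<otimes>\<^bsub>?A\<^esub> \<phi>"
        using \<beta> \<phi> by (auto simp: r_coset_def)
      have \<iota>F: "\<iota> \<in> F P P"
        using N.mem_carrier[OF \<iota>(1)] by (simp add: carrier_A)
      \<comment> \<open>In a right coset the inner factor is applied last, so it acts trivially on
        the element already moved by \<phi>.\<close>
      have "\<beta> = compose P \<iota> \<phi>"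
        using F.aut_group_mult[OF P \<iota>F \<phi>(1)] \<iota>(2) by simp
      then have "aut_act ?P \<beta> u = aut_act ?P \<iota> (aut_act ?P \<phi> u)"
        using P.aut_act_compose[OF auto[OF \<iota>F] auto[OF \<phi>(1)] u] by simp
      also have "\<dots> = aut_act ?P \<phi> u"
        using \<iota>(1) P.aut_act_marks(1)[OF auto[OF \<phi>(1)] u]
        by (intro P.aut_act_inner) (simp_all add: inn_def)
      finally show ?thesis
        using A.m_closed[of \<iota> \<phi>] \<iota>(2) \<iota>F \<phi>(1) by (simp add: carrier_A)
    qed
    have "(SOME \<beta>. \<beta> \<in> \<omega>) \<in> \<omega>"
      using \<alpha> by (rule someI[of "\<lambda>\<beta>. \<beta> \<in> \<omega>"])
    then show ?thesis
      using act \<alpha> by (simp add: out_act_def)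
  qed
  have rep: "\<exists>\<alpha>\<in>\<omega>. \<alpha> \<in> F P P" if \<omega>: "\<omega> \<in> carrier ?O" for \<omega>
  proof -
    obtain \<phi> where "\<phi> \<in> F P P" "\<omega> = inn S P #>\<^bsub>?A\<^esub> \<phi>"
      using \<omega> by (auto simp: out_group_def carrier_FactGroup carrier_A)
    then show ?thesis
      using A.rcos_self[OF _ N.is_subgroup] carrier_A by blast
  qed
  interpret odd_index_action "units_of ?R" ?O ?D T "out_act ?P"
  proof (intro odd_index_action.intro odd_index_action_axioms.intro)
    show "comm_group (units_of ?R)"
      by (rule R.units_comm_group)
    show "group ?O"
      by (rule F.group_out_group[OF P])
    show "u \<otimes>\<^bsub>units_of ?R\<^esub> u = \<one>\<^bsub>units_of ?R\<^esub>" if "u \<in> carrier (units_of ?R)" for u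
      using that P.burnside.Units_grothendieck_square[folded burnside_ring_def]
      by (simp add: units_of_carrier units_of_mult units_of_one)
    show "finite (carrier ?O)"
      using F.finite_F[OF P] by (simp add: out_group_def carrier_FactGroup carrier_A)
    show "subgroup ?D ?O"
      by (rule F.subgroup_out_group[OF P H])
    show "odd (card (lcosets\<^bsub>?O\<^esub> ?D))"
      using F.odd_index[OF P assms(3)] .
    show "left_transversal ?O ?D T"
      by fact
    fix \<omega> u assume \<omega>: "\<omega> \<in> carrier ?O" and "u \<in> carrier (units_of ?R)"
    then have u: "u \<in> Units ?R" "u \<in> carrier ?R"
      by (auto simp: units_of_carrier)
    obtain \<alpha> where \<alpha>: "\<alpha> \<in> \<omega>" "\<alpha> \<in> F P P"
      using rep[OF \<omega>] by blast
    show "out_act ?P \<omega> u \<in> carrier (units_of ?R)"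
      using out_act[OF \<omega> \<alpha>(1) u(2)] P.aut_act_Units[OF auto[OF \<alpha>(2)] u(1)]
      by (simp add: units_of_carrier)
    show "out_act ?P \<omega> (u \<otimes>\<^bsub>units_of ?R\<^esub> v) = out_act ?P \<omega> u \<otimes>\<^bsub>units_of ?R\<^esub> out_act ?P \<omega> v"
      if "v \<in> carrier (units_of ?R)" for v
    proof -
      have v: "v \<in> carrier ?R"
        using that by (auto simp: units_of_carrier)
      then show ?thesis
        using out_act[OF \<omega> \<alpha>(1)] P.aut_act_mult[OF auto[OF \<alpha>(2)]] u
        by (simp add: units_of_mult)
    qed
    show "out_act ?P (\<omega> \<otimes>\<^bsub>?O\<^esub> \<omega>') u = out_act ?P \<omega> (out_act ?P \<omega>' u)"
      if \<omega>': "\<omega>' \<in> carrier ?O" for \<omega>'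
    proof -
      obtain \<beta> where \<beta>: "\<beta> \<in> \<omega>'" "\<beta> \<in> F P P"
        using rep[OF \<omega>'] by blast
      \<comment> \<open>The product of two cosets contains the composite of their representatives,
        which reduces the claim to \<open>aut_act_compose\<close>.\<close>
      have "compose P \<alpha> \<beta> \<in> \<omega> \<otimes>\<^bsub>?O\<^esub> \<omega>'"
        using \<alpha> \<beta> F.aut_group_mult[OF P \<alpha>(2) \<beta>(2)] by (force simp: out_group_def set_mult_def)
      moreover have "\<omega> \<otimes>\<^bsub>?O\<^esub> \<omega>' \<in> carrier ?O"
        using group.is_monoid[OF F.group_out_group[OF P]] \<omega> \<omega>' by (simp add: monoid.m_closed)
      ultimately have "out_act ?P (\<omega> \<otimes>\<^bsub>?O\<^esub> \<omega>') u = aut_act ?P (compose P \<alpha> \<beta>) u"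
        using out_act u by blast
      also have "\<dots> = aut_act ?P \<alpha> (aut_act ?P \<beta> u)"
        using P.aut_act_compose[OF auto[OF \<alpha>(2)] auto[OF \<beta>(2)] u(2)] by simp
      also have "\<dots> = out_act ?P \<omega> (out_act ?P \<omega>' u)"
        using out_act[OF \<omega>' \<beta>(1) u(2)] out_act[OF \<omega> \<alpha>(1)]
          P.aut_act_marks(1)[OF auto[OF \<beta>(2)] u(2)] by simp
      finally show ?thesis .
    qed
  qed
  \<comment> \<open>The groups of fixed units and the trace map of the statement are those of the
    abstract setting, by unfolding.\<close>
  have "fixed_units ?P B = (units_of ?R)\<lparr>carrier := fixed B\<rparr>" for B
    by (simp add: fixed_units_def fixed_def units_of_carrier)
  moreover have "trace_map ?P T = tr"
    by (simp add: fun_eq_iff trace_map_def tr_def)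
  ultimately show ?thesis
    using split_surjective_tr internal_direct_product_tr by (simp add: Let_def)
qed

end
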